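(* Let $n\geqslant 3$ and let $g$ be a rotationally symmetric Riemannian metric on the $n$-sphere $\mathbb{S}^n$ such that \begin{itemize} \item $\mathrm{Scal}_g\geqslant n(n-1)$, \item $W_g\geqslant\omega_{n-1}$. \end{itemize} Then $(\mathbb{S}^n,g)$ is isometric to $(\mathbb{S}^n,g_{rd})$.
   Context: Notation. $g_{rd}$ denotes the unit round metric on a sphere (of the dimension indicated by context), $\omega_{n-1}$ is the volume of the unit round $(n-1)$-sphere, $\mathrm{Scal}_g$ is the scalar curvature, and $\mathrm{Vol}_g^{k}$ is the $k$-dimensional volume induced by $g$. Rotational symmetry. A (smooth) Riemannian metric $g$ on $\mathbb{S}^n$ is rotationally symmetric if, up to isometry, it has the form $g=ds^2+f(s)^2g_{rd}$ on $[0,D]\times\mathbb{S}^{n-1}$ (with $\{0\}\times\mathbb{S}^{n-1}$ and $\{D\}\times\mathbb{S}^{n-1}$ each collapsed to a point, the poles), where $f:[0,D]\to[0,\infty)$ is smooth, $f>0$ on $(0,D)$, $f(0)=f(D)=0$, $f'(0)=1$, $f'(D)=-1$, and all even-order derivatives of $f$ vanish at $0$ and $D$. Width. The canonical sweepout is the family $\{\Sigma_s\}_{s\in[0,D]}$, $\Sigma_s=\{s\}\times\mathbb{S}^{n-1}$ (the set of points at $g$-distance $s$ from the pole $s=0$), with induced metric $f(s)^2g_{rd}$. The width is $W_g:=\max_{s\in[0,D]}\mathrm{Vol}_g^{n-1}(\Sigma_s)=\omega_{n-1}\max_{s\in[0,D]} f(s)^{n-1}$. *)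

theory Defs
  imports "HOL-Analysis.Analysis"
begin

text \<open>
  The unit sphere of \<^typ>\<open>real \<times> 'a\<close> is the sphere of dimension \<open>DIM('a)\<close>; its local coordinates take
  values in \<^typ>\<open>'a\<close>. With \<open>'a = real \<times> real^'k\<close> and \<open>n = CARD('k) + 1\<close>, the sphere \<open>S^n\<close> is the
  unit sphere of \<open>real \<times> 'a\<close>, and \<open>S^(n-1)\<close> is the unit sphere of \<open>'a\<close> itself.
  A field of bilinear forms is a function \<open>g p u v\<close> of a point and two tangent vectors; on a sphere
  only its values at points of the sphere and vectors tangent there are meaningful.
\<close>

type_synonym 'a bilinear_field = "'a \<Rightarrow> 'a \<Rightarrow> 'a \<Rightarrow> real"

abbreviation unit_sphere :: "'a::euclidean_space set" where
  "unit_sphere \<equiv> sphere 0 1"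

definition tangent_space :: "'a::euclidean_space \<Rightarrow> 'a set" where
  "tangent_space p = {v. p \<bullet> v = 0}"


subsection \<open>Smoothness\<close>

text \<open>Only used for open \<open>U\<close>.\<close>

primrec Ck_on :: "nat \<Rightarrow> 'a::euclidean_space set \<Rightarrow> ('a \<Rightarrow> 'b::real_normed_vector) \<Rightarrow> bool" where
  "Ck_on 0 U f \<longleftrightarrow> continuous_on U f"
| "Ck_on (Suc k) U f \<longleftrightarrow>
     (\<forall>x\<in>U. f differentiable (at x)) \<and> (\<forall>v. Ck_on k U (\<lambda>x. frechet_derivative f (at x) v))"

definition smooth_on :: "'a::euclidean_space set \<Rightarrow> ('a \<Rightarrow> 'b::real_normed_vector) \<Rightarrow> bool" where
  "smooth_on U f \<longleftrightarrow> (\<forall>k. Ck_on k U f)"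

text \<open>
  A map \<open>F\<close> on the unit sphere is identified with its extension \<open>x \<mapsto> F (x / |x|)\<close>, where
  \<open>x / |x|\<close> is \<^term>\<open>sgn x\<close>. The map is smooth on the sphere iff this extension is smooth away from
  the origin, and the derivative of the extension at a point \<open>p\<close> of the sphere restricts on the
  tangent space to the differential of \<open>F\<close>.
\<close>

definition smooth_on_sphere :: "('a::euclidean_space \<Rightarrow> 'b::real_normed_vector) \<Rightarrow> bool" where
  "smooth_on_sphere F \<longleftrightarrow> smooth_on (- {0}) (\<lambda>x. F (sgn x))"

definition sphere_diffeo :: "('a::euclidean_space \<Rightarrow> 'a) \<Rightarrow> bool" where
  "sphere_diffeo F \<longleftrightarrow>
     bij_betw F unit_sphere unit_sphere \<and>
     smooth_on_sphere F \<and> smooth_on_sphere (inv_into unit_sphere F)"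

definition pullback ::
  "('a::euclidean_space \<Rightarrow> 'b::euclidean_space) \<Rightarrow> 'b bilinear_field \<Rightarrow> 'a bilinear_field" where
  "pullback \<phi> g x u v =
     g (\<phi> x) (frechet_derivative \<phi> (at x) u) (frechet_derivative \<phi> (at x) v)"

definition sphere_pullback ::
  "('a::euclidean_space \<Rightarrow> 'b::euclidean_space) \<Rightarrow> 'b bilinear_field \<Rightarrow> 'a bilinear_field" where
  "sphere_pullback F g p u v = pullback (\<lambda>x. F (sgn x)) g p u v"


subsection \<open>Riemannian metrics on spheres\<close>

definition local_param :: "'a::euclidean_space set \<Rightarrow> ('a \<Rightarrow> real \<times> 'a) \<Rightarrow> bool" where
  "local_param U \<phi> \<longleftrightarrow>
     open U \<and> smooth_on U \<phi> \<and> \<phi> ` U \<subseteq> unit_sphere \<and> inj_on \<phi> U \<and>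
     (\<forall>x\<in>U. inj (frechet_derivative \<phi> (at x)))"

definition riemannian_metric :: "(real \<times> 'a::euclidean_space) bilinear_field \<Rightarrow> bool" where
  "riemannian_metric g \<longleftrightarrow>
     (\<forall>p\<in>unit_sphere. \<forall>u\<in>tangent_space p. \<forall>v\<in>tangent_space p.
        g p u v = g p v u \<and>
        (\<forall>w\<in>tangent_space p. g p (u + w) v = g p u v + g p w v) \<and>
        (\<forall>c. g p (c *\<^sub>R u) v = c * g p u v) \<and>
        (u \<noteq> 0 \<longrightarrow> g p u u > 0)) \<and>
     (\<forall>U \<phi>. local_param U \<phi> \<longrightarrow>
        (\<forall>i\<in>Basis. \<forall>j\<in>Basis. smooth_on U (\<lambda>x. pullback \<phi> g x i j)))"

definition round_metric :: "'a::euclidean_space bilinear_field" where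
  "round_metric p u v = u \<bullet> v"

definition isometric ::
  "(real \<times> 'a::euclidean_space) bilinear_field \<Rightarrow> (real \<times> 'a) bilinear_field \<Rightarrow> bool" where
  "isometric g g' \<longleftrightarrow>
     (\<exists>F. sphere_diffeo F \<and>
        (\<forall>p\<in>unit_sphere. \<forall>u\<in>tangent_space p. \<forall>v\<in>tangent_space p.
           sphere_pullback F g' p u v = g p u v))"


subsection \<open>Scalar curvature in local coordinates\<close>

text \<open>
  Here \<open>h\<close> is a metric on an open subset of a Euclidean space. The vector \<^term>\<open>sharp h x c\<close> is
  the one with \<open>h x (sharp h x c) w = c \<bullet> w\<close> for all \<open>w\<close>, so the inverse matrix has the entries
  \<open>h^(ij) = sharp h x i \<bullet> j\<close>. In \<open>riemann\<close>, vectors stand for constant vector fields, whose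
  Lie brackets vanish. The sign convention makes the scalar curvature of the round n-sphere \<open>n (n - 1)\<close>.
\<close>

definition sharp :: "'a::euclidean_space bilinear_field \<Rightarrow> 'a \<Rightarrow> 'a \<Rightarrow> 'a" where
  "sharp h x = inv (\<lambda>v. \<Sum>i\<in>Basis. h x v i *\<^sub>R i)"

definition christoffel :: "'a::euclidean_space bilinear_field \<Rightarrow> 'a \<Rightarrow> 'a \<Rightarrow> 'a \<Rightarrow> 'a" where
  "christoffel h x u v = sharp h x (\<Sum>w\<in>Basis. (1/2 *
     (frechet_derivative (\<lambda>y. h y v w) (at x) u
    + frechet_derivative (\<lambda>y. h y u w) (at x) v
    - frechet_derivative (\<lambda>y. h y u v) (at x) w)) *\<^sub>R w)"

definition riemann :: "'a::euclidean_space bilinear_field \<Rightarrow> 'a \<Rightarrow> 'a \<Rightarrow> 'a \<Rightarrow> 'a \<Rightarrow> 'a" where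
  "riemann h x u v w =
     frechet_derivative (\<lambda>y. christoffel h y v w) (at x) u
   - frechet_derivative (\<lambda>y. christoffel h y u w) (at x) v
   + christoffel h x u (christoffel h x v w)
   - christoffel h x v (christoffel h x u w)"

definition ricci :: "'a::euclidean_space bilinear_field \<Rightarrow> 'a \<Rightarrow> 'a \<Rightarrow> 'a \<Rightarrow> real" where
  "ricci h x v w = (\<Sum>i\<in>Basis. riemann h x i v w \<bullet> i)"

definition scalar_curvature :: "'a::euclidean_space bilinear_field \<Rightarrow> 'a \<Rightarrow> real" where
  "scalar_curvature h x = (\<Sum>i\<in>Basis. \<Sum>j\<in>Basis. (sharp h x i \<bullet> j) * ricci h x i j)"

text \<open>
  Scalar curvature is independent of coordinates, so a bound on it at every point of the sphere is
  the same bound in every local parametrization.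
\<close>

definition scal_ge :: "(real \<times> 'a::euclidean_space) bilinear_field \<Rightarrow> real \<Rightarrow> bool" where
  "scal_ge g c \<longleftrightarrow>
     (\<forall>U \<phi>. local_param U \<phi> \<longrightarrow> (\<forall>x\<in>U. scalar_curvature (pullback \<phi> g) x \<ge> c))"


subsection \<open>Rotational symmetry\<close>

definition deriv_within :: "real set \<Rightarrow> (real \<Rightarrow> real) \<Rightarrow> real \<Rightarrow> real" where
  "deriv_within S f x = vector_derivative f (at x within S)"

definition warping_function :: "real \<Rightarrow> (real \<Rightarrow> real) \<Rightarrow> bool" where
  "warping_function D f \<longleftrightarrow>
     0 < D \<and>
     (\<forall>k. \<forall>s\<in>{0..D}. (deriv_within {0..D} ^^ k) f differentiable (at s within {0..D})) \<and>
     (\<forall>s\<in>{0<..<D}. f s > 0) \<and> f 0 = 0 \<and> f D = 0 \<and>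
     deriv_within {0..D} f 0 = 1 \<and> deriv_within {0..D} f D = - 1 \<and>
     (\<forall>k. even k \<longrightarrow> (deriv_within {0..D} ^^ k) f 0 = 0 \<and> (deriv_within {0..D} ^^ k) f D = 0)"

text \<open>
  The map \<^term>\<open>polar D\<close> identifies \<open>[0,D] \<times> S^(n-1)\<close>, with each end collapsed to a point, with \<open>S^n\<close>.
  A metric has the form \<open>ds\<^sup>2 + f(s)\<^sup>2 g_rd\<close> up to isometry if, for some diffeomorphism \<open>\<psi>\<close> of \<open>S^n\<close>,
  the pullback of its \<open>\<psi>\<close>-pullback under \<^term>\<open>polar D\<close> is that warped product away from the ends.
\<close>

definition polar :: "real \<Rightarrow> real \<times> 'a::euclidean_space \<Rightarrow> real \<times> 'a" where
  "polar D = (\<lambda>(s, \<theta>). (cos (pi * s / D), sin (pi * s / D) *\<^sub>R \<theta>))"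

definition rotationally_symmetric_via ::
  "real \<Rightarrow> (real \<Rightarrow> real) \<Rightarrow> (real \<times> 'a \<Rightarrow> real \<times> 'a) \<Rightarrow>
     (real \<times> 'a::euclidean_space) bilinear_field \<Rightarrow> bool" where
  "rotationally_symmetric_via D f \<psi> g \<longleftrightarrow>
     warping_function D f \<and> sphere_diffeo \<psi> \<and>
     (\<forall>s\<in>{0<..<D}. \<forall>\<theta>\<in>unit_sphere. \<forall>a b. \<forall>v\<in>tangent_space \<theta>. \<forall>w\<in>tangent_space \<theta>.
        pullback (polar D) (sphere_pullback \<psi> g) (s, \<theta>) (a, v) (b, w)
          = a * b + (f s)\<^sup>2 * round_metric \<theta> v w)"


subsection \<open>Volume and width\<close>

text \<open>The inverse stereographic projection parametrizes the sphere up to one point.\<close>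

definition stereo_inv :: "'a::euclidean_space \<Rightarrow> real \<times> 'a" where
  "stereo_inv y = (((norm y)\<^sup>2 - 1) / ((norm y)\<^sup>2 + 1), (2 / ((norm y)\<^sup>2 + 1)) *\<^sub>R y)"

definition sphere_volume :: "(real \<times> (real^'k)) bilinear_field \<Rightarrow> ennreal" where
  "sphere_volume h =
     (\<integral>\<^sup>+ y. ennreal (sqrt (det (\<chi> i j. pullback stereo_inv h y (axis i 1) (axis j 1)))) \<partial>lborel)"

text \<open>
  The slice \<open>\<Sigma>_s\<close> is parametrized by \<open>\<theta> \<mapsto> \<psi> (polar D (s, \<theta>))\<close>, with the metric pulled back to
  \<open>S^(n-1)\<close>; at both ends this form is zero and so is the volume. The volume is
  continuous in \<open>s\<close>, so the supremum defining the width is a maximum.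
\<close>

definition slice_volume ::
  "real \<Rightarrow> (real \<times> (real \<times> (real^'k)) \<Rightarrow> real \<times> (real \<times> (real^'k))) \<Rightarrow>
     (real \<times> (real \<times> (real^'k))) bilinear_field \<Rightarrow> real \<Rightarrow> ennreal" where
  "slice_volume D \<psi> g s = sphere_volume (sphere_pullback (\<lambda>\<theta>. \<psi> (polar D (s, \<theta>))) g)"

definition width ::
  "real \<Rightarrow> (real \<times> (real \<times> (real^'k)) \<Rightarrow> real \<times> (real \<times> (real^'k))) \<Rightarrow>
     (real \<times> (real \<times> (real^'k))) bilinear_field \<Rightarrow> ennreal" where
  "width D \<psi> g = (SUP s\<in>{0..D}. slice_volume D \<psi> g s)"

end

theory Submission
  imports Defs "HOL-Probability.Sinc_Integral"
begin

text \<open>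
  For \<open>g = ds^2 + f^2 g_rd\<close> the bound on the scalar curvature reads
  \<open>(n - 2) (1 - f'^2) - 2 f f'' \<ge> n f^2\<close>. Hence \<open>F = f^(n-2) (1 - f'^2 - f^2)\<close>, whose derivative is
  \<open>f'\<close> times a nonnegative factor, is monotone wherever \<open>f\<close> is. The bound on the width says that the
  maximum of \<open>f\<close>, attained at some \<open>s0\<close>, is at least \<open>1\<close>, so \<open>F s0 \<le> 0\<close>. Going left from \<open>s0\<close>, a
  first critical point \<open>a > 0\<close> would satisfy \<open>F a \<le> F s0 \<le> 0\<close>, hence \<open>f a \<ge> 1\<close>, and the inequality would
  give \<open>f'' a < 0\<close>, contradicting \<open>f' > 0\<close> to the right of \<open>a\<close>. So \<open>f' > 0\<close> on \<open>(0, s0)\<close>, and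
  \<open>0 = F 0 \<le> F \<le> F s0 \<le> 0\<close> forces \<open>f'^2 + f^2 = 1\<close>, that is \<open>f = sin\<close>. By symmetry the same holds on
  the right of \<open>s0\<close>.
\<close>

section \<open>Smooth maps\<close>

text \<open>The quantity \<open>F\<close> is the first integral of the equality case: if
  \<open>(n - 2) (1 - f'^2) - 2 f f'' = n f^2\<close>, then \<open>F\<close> is constant, and
  \<open>sin\<close> is a profile with constant 0. Three features of the setting shape the rest. The
  curvature bound is available only through local parametrizations, so an explicit chart with metric
  \<open>ds^2 + (f \<lambda>)^2 |dy|^2\<close> has to be built, where \<open>\<lambda>\<close> is
  the conformal factor of the stereographic projection; as the inequality for \<open>f\<close>
  involves \<open>s\<close> alone, the curvature is evaluated only over the centre
  \<open>y = 0\<close>. The volume of the unit sphere is never computed: being positive and finite,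
  it cancels from the width bound. Finally, the warped form is given only away from the poles, so
  once \<open>f = sin\<close> is known, the metric at the poles is recovered by continuity in a
  chart around each of them.\<close>

lemma frechet_derivative_cong_open:
  assumes "open U" "x \<in> U" "\<And>y. y \<in> U \<Longrightarrow> f y = g y"
  shows "frechet_derivative f (at x) = frechet_derivative g (at x)"
proof -
  have "(f has_derivative F) (at x) \<longleftrightarrow> (g has_derivative F) (at x)" for F
    using assms by (metis has_derivative_transform_within_open)
  then show ?thesis
    unfolding frechet_derivative_def by simp
qed

lemma differentiable_cong_open:
  assumes "open U" "x \<in> U" "\<And>y. y \<in> U \<Longrightarrow> f y = g y"
  shows "f differentiable (at x) \<longleftrightarrow> g differentiable (at x)"
  using assms unfolding differentiable_def by (metis has_derivative_transform_within_open)

lemma frechet_derivative_has_derivative: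
  assumes "f differentiable (at x)"
  shows "(f has_derivative (\<lambda>v. frechet_derivative f (at x) v)) (at x)"
  using assms by (simp add: frechet_derivative_works)

lemma frechet_derivative_eq:
  assumes "(f has_derivative F) (at x)"
  shows "frechet_derivative f (at x) v = F v"
  using frechet_derivative_at[OF assms] by simp

text \<open>Openness lets equality on \<open>U\<close> pass to the derivatives at points of
  \<open>U\<close>, which keeps the induction going.\<close>

lemma Ck_on_cong:
  assumes "open U" "\<And>x. x \<in> U \<Longrightarrow> f x = g x"
  shows "Ck_on k U f \<longleftrightarrow> Ck_on k U g"
  using assms(2)
proof (induction k arbitrary: f g)
  case 0
  then show ?case by (simp cong: continuous_on_cong)
next
  case (Suc k)
  have "(\<forall>x\<in>U. f differentiable (at x)) \<longleftrightarrow> (\<forall>x\<in>U. g differentiable (at x))"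
    using differentiable_cong_open[OF \<open>open U\<close>] Suc.prems by blast
  moreover have "Ck_on k U (\<lambda>x. frechet_derivative f (at x) v)
      \<longleftrightarrow> Ck_on k U (\<lambda>x. frechet_derivative g (at x) v)" for v
    by (rule Suc.IH) (use frechet_derivative_cong_open[OF \<open>open U\<close>] Suc.prems in metis)
  ultimately show ?case by simp
qed

text \<open>\<open>Ck_on\<close> refers to \<open>frechet_derivative\<close>, a choice operator;
  with this rule any explicitly known derivative can take its place.\<close>

lemma Ck_on_SucI:
  assumes "open U" "\<And>x. x \<in> U \<Longrightarrow> (f has_derivative (\<lambda>v. f' v x)) (at x)"
    and "\<And>v. Ck_on k U (f' v)"
  shows "Ck_on (Suc k) U f"
proof -
  have "Ck_on k U (\<lambda>x. frechet_derivative f (at x) v)" for v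
    using Ck_on_cong[OF assms(1), of "\<lambda>x. frechet_derivative f (at x) v" "f' v"]
      frechet_derivative_eq[OF assms(2)] assms(3) by blast
  then show ?thesis
    using assms(2) unfolding Ck_on.simps differentiable_def by blast
qed

lemma Ck_on_Suc_imp: "Ck_on (Suc k) U f \<Longrightarrow> Ck_on k U f"
proof (induction k arbitrary: f)
  case 0
  then show ?case
    by (auto intro!: continuous_at_imp_continuous_on differentiable_imp_continuous_within)
next
  case (Suc k)
  then show ?case by (metis Ck_on.simps(2))
qed

lemma Ck_on_has_derivative:
  assumes "Ck_on (Suc k) U f" "x \<in> U"
  shows "(f has_derivative (\<lambda>v. frechet_derivative f (at x) v)) (at x)"
  using assms frechet_derivative_has_derivative by auto

lemma Ck_on_const: "Ck_on k U (\<lambda>x. c)"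
proof (induction k arbitrary: c)
  case (Suc k)
  have "frechet_derivative (\<lambda>x. c) (at x) v = 0" for x :: 'a and v
    by (rule frechet_derivative_eq) simp
  then show ?case using Suc by simp
qed simp

lemma Ck_on_bounded_linear:
  assumes "open U" "bounded_linear L" "Ck_on k U f"
  shows "Ck_on k U (\<lambda>x. L (f x))"
  using assms(3)
proof (induction k arbitrary: f)
  case 0
  then show ?case
    using assms(2) by (auto intro: bounded_linear.continuous_on)
next
  case (Suc k)
  show ?case
  proof (rule Ck_on_SucI[OF \<open>open U\<close>])
    show "((\<lambda>x. L (f x)) has_derivative (\<lambda>v. L (frechet_derivative f (at x) v))) (at x)"
      if "x \<in> U" for x
      using bounded_linear.has_derivative[OF assms(2) Ck_on_has_derivative[OF Suc.prems that]] .
    show "Ck_on k U (\<lambda>x. L (frechet_derivative f (at x) v))" for v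
      using Suc by simp
  qed
qed

lemma Ck_on_ident:
  assumes "open U"
  shows "Ck_on k U (\<lambda>x. x)"
proof (cases k)
  case (Suc j)
  show ?thesis unfolding Suc
    by (rule Ck_on_SucI[OF assms, where f' = "\<lambda>v x. v"]) (auto intro: Ck_on_const)
qed simp

lemma Ck_on_linear: "open U \<Longrightarrow> bounded_linear L \<Longrightarrow> Ck_on k U L"
  using Ck_on_bounded_linear[OF _ _ Ck_on_ident] .

lemma Ck_on_add:
  assumes "open U" "Ck_on k U f" "Ck_on k U g"
  shows "Ck_on k U (\<lambda>x. f x + g x)"
  using assms(2,3)
proof (induction k arbitrary: f g)
  case (Suc k)
  show ?case
  proof (rule Ck_on_SucI[OF \<open>open U\<close>])
    show "((\<lambda>x. f x + g x) has_derivative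
        (\<lambda>v. frechet_derivative f (at x) v + frechet_derivative g (at x) v)) (at x)"
      if "x \<in> U" for x
      by (intro has_derivative_add Ck_on_has_derivative[OF _ that]) (use Suc.prems in blast)+
  qed (use Suc in simp)
qed (simp add: continuous_on_add)

lemma Ck_on_Pair:
  assumes "open U" "Ck_on k U f" "Ck_on k U g"
  shows "Ck_on k U (\<lambda>x. (f x, g x))"
proof -
  have "bounded_linear (\<lambda>a. (a, 0))" "bounded_linear (\<lambda>b. (0, b))"
    by (auto intro!: bounded_linear_Pair bounded_linear_ident bounded_linear_zero)
  then have "Ck_on k U (\<lambda>x. (f x, 0) + (0, g x))"
    using assms by (intro Ck_on_add Ck_on_bounded_linear[of U "\<lambda>a. (a, 0)" k f]
        Ck_on_bounded_linear[of U "\<lambda>b. (0, b)" k g])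
  then show ?thesis by simp
qed

lemma Ck_on_sum:
  assumes "open U" "finite I" "\<And>i. i \<in> I \<Longrightarrow> Ck_on k U (f i)"
  shows "Ck_on k U (\<lambda>x. \<Sum>i\<in>I. f i x)"
  using assms(2,3) by (induction I) (auto intro: Ck_on_const Ck_on_add[OF assms(1)])

text \<open>One product rule serves scalar multiplication and inner products alike. Each summand
  keeps one undifferentiated factor, which \<open>Ck_on_Suc_imp\<close> lowers to order
  \<open>k\<close>.\<close>

lemma Ck_on_bilinear:
  assumes "open U" "bounded_bilinear B" "Ck_on k U f" "Ck_on k U g"
  shows "Ck_on k U (\<lambda>x. B (f x) (g x))"
  using assms(3,4)
proof (induction k arbitrary: f g)
  case 0
  then show ?case using bounded_bilinear.continuous_on[OF assms(2)] by auto
next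
  case (Suc k)
  show ?case
  proof (rule Ck_on_SucI[OF \<open>open U\<close>])
    show "((\<lambda>x. B (f x) (g x)) has_derivative
        (\<lambda>v. B (f x) (frechet_derivative g (at x) v) + B (frechet_derivative f (at x) v) (g x))) (at x)"
      if "x \<in> U" for x
      by (intro bounded_bilinear.FDERIV[OF assms(2)] Ck_on_has_derivative[OF _ that])
        (use Suc.prems in blast)+
    show "Ck_on k U (\<lambda>x. B (f x) (frechet_derivative g (at x) v)
        + B (frechet_derivative f (at x) v) (g x))" for v
      using Suc.prems Suc.prems[THEN Ck_on_Suc_imp] unfolding Ck_on.simps
      by (intro Ck_on_add[OF assms(1)] Suc.IH) blast+
  qed
qed

lemma linear_expand_Basis:
  fixes L :: "'a::euclidean_space \<Rightarrow> 'b::real_vector"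
  assumes "linear L"
  shows "L w = (\<Sum>b\<in>Basis. (w \<bullet> b) *\<^sub>R L b)"
proof -
  have "L w = L (\<Sum>b\<in>Basis. (w \<bullet> b) *\<^sub>R b)"
    by (simp add: euclidean_representation)
  also have "\<dots> = (\<Sum>b\<in>Basis. (w \<bullet> b) *\<^sub>R L b)"
    by (simp only: linear_sum[OF assms] linear_scale[OF assms])
  finally show ?thesis .
qed

text \<open>The chain rule differentiates \<open>f\<close> in a direction that varies with
  \<open>x\<close>, whereas the induction hypothesis covers fixed directions only. Expanding that
  direction in the basis leaves a finite sum of products with fixed directions.\<close>

lemma Ck_on_compose:
  fixes f :: "'b::euclidean_space \<Rightarrow> 'c::real_normed_vector" and g :: "'a::euclidean_space \<Rightarrow> 'b"
  assumes "open U" "g ` U \<subseteq> V" "Ck_on k V f" "Ck_on k U g"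
  shows "Ck_on k U (\<lambda>x. f (g x))"
  using assms(3,4)
proof (induction k arbitrary: f)
  case 0
  then show ?case using assms(2) by (auto intro: continuous_on_compose2)
next
  case (Suc k)
  show ?case
  proof (rule Ck_on_SucI[OF \<open>open U\<close>])
    show "((\<lambda>x. f (g x)) has_derivative (\<lambda>v. \<Sum>b\<in>Basis. (frechet_derivative g (at x) v \<bullet> b) *\<^sub>R
        frechet_derivative f (at (g x)) b)) (at x)" if "x \<in> U" for x
    proof -
      have f: "(f has_derivative frechet_derivative f (at (g x))) (at (g x))"
        using Ck_on_has_derivative[OF Suc.prems(1)] that assms(2) by blast
      show ?thesis
        by (rule has_derivative_eq_rhs[OF
              has_derivative_compose[OF Ck_on_has_derivative[OF Suc.prems(2) that] f]])
          (intro ext linear_expand_Basis has_derivative_linear[OF f])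
    qed
    have "Ck_on k U (\<lambda>x. frechet_derivative f (at (g x)) b)" for b
      using Suc.prems Ck_on_Suc_imp[OF Suc.prems(2)] by (intro Suc.IH) auto
    moreover have "Ck_on k U (\<lambda>x. frechet_derivative g (at x) v \<bullet> b)" for v b
      by (rule Ck_on_bounded_linear[OF assms(1) bounded_linear_inner_left])
        (use Suc.prems(2) in simp)
    ultimately have "Ck_on k U (\<lambda>x. (frechet_derivative g (at x) v \<bullet> b) *\<^sub>R
        frechet_derivative f (at (g x)) b)" for v b
      using Ck_on_bilinear[OF assms(1) bounded_bilinear_scaleR] by blast
    then show "Ck_on k U (\<lambda>x. \<Sum>b\<in>Basis. (frechet_derivative g (at x) v \<bullet> b) *\<^sub>R
        frechet_derivative f (at (g x)) b)" for v
      by (rule Ck_on_sum[OF assms(1) finite_Basis])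
  qed
qed

text \<open>Each function is the derivative of the other up to sign, hence the joint induction; the
  free constant \<open>c\<close> absorbs the sign and the direction \<open>v\<close>.\<close>

lemma Ck_on_sin_cos:
  "Ck_on k UNIV (\<lambda>x::real. c * sin x) \<and> Ck_on k UNIV (\<lambda>x::real. c * cos x)"
proof (induction k arbitrary: c)
  case 0
  then show ?case by (auto intro!: continuous_intros)
next
  case (Suc k)
  have "((\<lambda>x. c * sin x) has_derivative (\<lambda>v. (c * v) * cos x)) (at x)"
    "((\<lambda>x. c * cos x) has_derivative (\<lambda>v. (- c * v) * sin x)) (at x)" for x
    by (auto intro!: derivative_eq_intros simp: algebra_simps)
  moreover have "Ck_on k UNIV (\<lambda>x::real. (c * v) * cos x)" "Ck_on k UNIV (\<lambda>x::real. (- c * v) * sin x)" for v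
    using Suc by blast+
  ultimately show ?case
    using Ck_on_SucI[OF open_UNIV, of "\<lambda>x. c * sin x" "\<lambda>v x. (c * v) * cos x"]
      Ck_on_SucI[OF open_UNIV, of "\<lambda>x. c * cos x" "\<lambda>v x. (- c * v) * sin x"] by blast
qed

lemma Ck_on_sin: "Ck_on k UNIV (sin :: real \<Rightarrow> real)"
  and Ck_on_cos: "Ck_on k UNIV (cos :: real \<Rightarrow> real)"
  using Ck_on_sin_cos[of k 1] by simp_all

section \<open>Scalar curvature of a warped product\<close>

lemma sum_Basis_real_prod:
  fixes F :: "real \<times> 'b::euclidean_space \<Rightarrow> 'c::comm_monoid_add"
  shows "sum F Basis = F (1, 0) + (\<Sum>e\<in>Basis. F (0, e))"
proof -
  have "inj_on (\<lambda>v::'b. (0::real, v)) Basis" by (auto intro: inj_onI)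
  moreover have "(Basis :: (real \<times> 'b) set) = insert (1, 0) ((\<lambda>v. (0, v)) ` Basis)"
    unfolding Basis_prod_def by simp
  moreover have "(1::real, 0::'b) \<notin> (\<lambda>v. (0, v)) ` Basis" by auto
  ultimately have "sum F Basis = F (1, 0) + sum F ((\<lambda>v. (0, v)) ` Basis)"
    by (metis (no_types, lifting) finite_Basis finite_imageI sum.insert)
  then show ?thesis
    using sum.reindex[OF \<open>inj_on (\<lambda>v::'b. (0::real, v)) Basis\<close>, of F] by (simp add: o_def)
qed

lemma sharp_warped:
  fixes h :: "(real \<times> 'b::euclidean_space) bilinear_field"
  assumes "\<And>u v. h x u v = fst u * fst v + e * (snd u \<bullet> snd v)" "e \<noteq> 0"
  shows "sharp h x c = (fst c, (1 / e) *\<^sub>R snd c)"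
proof -
  have "(\<Sum>i\<in>Basis. h x v i *\<^sub>R i) = (fst v, e *\<^sub>R snd v)" for v
  proof -
    have "(\<Sum>i\<in>Basis. h x v i *\<^sub>R i) = (\<Sum>i\<in>Basis. ((fst v, e *\<^sub>R snd v) \<bullet> i) *\<^sub>R i)"
      by (simp add: assms(1) inner_prod_def)
    then show ?thesis by (simp only: euclidean_representation)
  qed
  then have "sharp h x = inv (\<lambda>v. (fst v, e *\<^sub>R snd v))"
    unfolding sharp_def by simp
  also have "\<dots> = (\<lambda>c. (fst c, (1 / e) *\<^sub>R snd c))"
    by (rule inv_equality) (use assms(2) in auto)
  finally show ?thesis by simp
qed

text \<open>The metric varies only through \<open>e\<close>, whose radial derivative is
  \<open>\<alpha>\<close> and whose gradient in the second factor is \<open>\<beta>\<close>.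
  Koszul's formula gives the covector \<open>?c\<close>, and raising the index divides its second
  component by \<open>e\<close>.\<close>

lemma christoffel_warped:
  fixes h :: "(real \<times> 'b::euclidean_space) bilinear_field"
  assumes "open U" "x \<in> U"
    and h: "\<And>y u v. y \<in> U \<Longrightarrow> h y u v = fst u * fst v + e y * (snd u \<bullet> snd v)"
    and e: "(e has_derivative (\<lambda>w. \<alpha> * fst w + \<beta> \<bullet> snd w)) (at x)" "e x \<noteq> 0"
  shows "christoffel h x u v = (- (\<alpha> / 2) * (snd u \<bullet> snd v),
    (1 / (2 * e x)) *\<^sub>R ((\<alpha> * fst u + \<beta> \<bullet> snd u) *\<^sub>R snd v + (\<alpha> * fst v + \<beta> \<bullet> snd v) *\<^sub>R snd u
      - (snd u \<bullet> snd v) *\<^sub>R \<beta>))"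
proof -
  have dh: "frechet_derivative (\<lambda>y. h y u v) (at x) w = (\<alpha> * fst w + \<beta> \<bullet> snd w) * (snd u \<bullet> snd v)"
    for u v w
  proof -
    have "frechet_derivative (\<lambda>y. h y u v) (at x) w
        = frechet_derivative (\<lambda>y. fst u * fst v + e y * (snd u \<bullet> snd v)) (at x) w"
      using frechet_derivative_cong_open[OF assms(1,2), of "\<lambda>y. h y u v"] h by simp
    also have "\<dots> = (\<alpha> * fst w + \<beta> \<bullet> snd w) * (snd u \<bullet> snd v)"
      by (rule frechet_derivative_eq) (auto intro!: derivative_eq_intros e(1))
    finally show ?thesis .
  qed
  let ?c = "(- (\<alpha> / 2) * (snd u \<bullet> snd v), (1 / 2) *\<^sub>R ((\<alpha> * fst u + \<beta> \<bullet> snd u) *\<^sub>R snd v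
      + (\<alpha> * fst v + \<beta> \<bullet> snd v) *\<^sub>R snd u - (snd u \<bullet> snd v) *\<^sub>R \<beta>))"
  have "(\<Sum>w\<in>Basis. (1/2 * (frechet_derivative (\<lambda>y. h y v w) (at x) u
    + frechet_derivative (\<lambda>y. h y u w) (at x) v
    - frechet_derivative (\<lambda>y. h y u v) (at x) w)) *\<^sub>R w) = (\<Sum>w\<in>Basis. (?c \<bullet> w) *\<^sub>R w)"
    by (rule sum.cong[OF refl]) (simp add: dh inner_prod_def algebra_simps inner_commute)
  also have "\<dots> = ?c" by (rule euclidean_representation)
  finally show ?thesis
    unfolding christoffel_def using sharp_warped[of h x "e x" ?c] h[OF assms(2)] e(2) by simp
qed

text \<open>The conformal factor of the inverse stereographic projection: the round metric reads
  \<open>stereo_factor y ^ 2\<close> times the flat one.\<close>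

definition stereo_factor :: "'b::euclidean_space \<Rightarrow> real" where
  "stereo_factor y = 2 / (1 + y \<bullet> y)"

lemma stereo_factor_pos: "stereo_factor y > 0"
  unfolding stereo_factor_def by (simp add: add_pos_nonneg)

lemma has_derivative_stereo_factor:
  "(stereo_factor has_derivative (\<lambda>p. - (stereo_factor y)\<^sup>2 * (y \<bullet> p))) (at y)"
proof -
  have "1 + y \<bullet> y \<noteq> 0" by (metis add_pos_nonneg inner_ge_zero less_irrefl zero_less_one)
  then show ?thesis
    unfolding stereo_factor_def
    by (auto intro!: derivative_eq_intros simp: inner_commute power2_eq_square divide_simps)
qed

lemma christoffel_warped_sphere:
  fixes h :: "(real \<times> 'b::euclidean_space) bilinear_field" and y :: 'b
  assumes "open U" "(s, y) \<in> U"
    and h: "\<forall>x\<in>U. \<forall>u v. h x u v =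
      fst u * fst v + (f (fst x) * stereo_factor (snd x))\<^sup>2 * (snd u \<bullet> snd v)"
    and f: "(f has_real_derivative f') (at s)" "f s \<noteq> 0"
  shows "christoffel h (s, y) (a, p) (b, q) = (- (f s * f' * (stereo_factor y)\<^sup>2) * (p \<bullet> q),
    (f' / f s * a - stereo_factor y * (y \<bullet> p)) *\<^sub>R q + (f' / f s * b - stereo_factor y * (y \<bullet> q)) *\<^sub>R p
      + (stereo_factor y * (p \<bullet> q)) *\<^sub>R y)"
proof -
  let ?e = "\<lambda>x. (f (fst x) * stereo_factor (snd x))\<^sup>2"
  let ?l = "stereo_factor y"
  have "((f \<circ> fst) has_derivative ((\<lambda>t. f' * t) \<circ> fst)) (at (s, y))"
    using f(1) by (intro diff_chain_at) (auto simp: has_field_derivative_def intro: derivative_eq_intros)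
  moreover have "((stereo_factor \<circ> snd) has_derivative ((\<lambda>p. - ?l\<^sup>2 * (y \<bullet> p)) \<circ> snd)) (at (s, y))"
    using has_derivative_stereo_factor[of y]
    by (intro diff_chain_at) (auto intro: derivative_eq_intros)
  \<comment> \<open>The coefficients are the \<open>\<alpha>\<close> and \<open>\<beta>\<close> of
    the general formula; dividing them by \<open>2 * e\<close> leaves \<open>f' / f\<close> and
    \<open>- \<lambda> y\<close>.\<close>
  ultimately have "(?e has_derivative (\<lambda>w. (2 * f s * f' * ?l\<^sup>2) * fst w
      + ((- 2 * (f s)\<^sup>2 * ?l ^ 3) *\<^sub>R y) \<bullet> snd w)) (at (s, y))"
    unfolding o_def
    by (auto intro!: derivative_eq_intros simp: power2_eq_square power3_eq_cube algebra_simps)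
  note c = christoffel_warped[OF assms(1,2) _ this, of h]
  have l: "?l \<noteq> 0" using stereo_factor_pos[of y] by simp
  have "christoffel h (s, y) (a, p) (b, q) =
      (- (2 * f s * f' * ?l\<^sup>2 / 2) * (p \<bullet> q),
       (1 / (2 * (f s * ?l)\<^sup>2)) *\<^sub>R
         ((2 * f s * f' * ?l\<^sup>2 * a + ((- 2 * (f s)\<^sup>2 * ?l ^ 3) *\<^sub>R y) \<bullet> p) *\<^sub>R q
        + (2 * f s * f' * ?l\<^sup>2 * b + ((- 2 * (f s)\<^sup>2 * ?l ^ 3) *\<^sub>R y) \<bullet> q) *\<^sub>R p
        - (p \<bullet> q) *\<^sub>R ((- 2 * (f s)\<^sup>2 * ?l ^ 3) *\<^sub>R y)))"
    by (subst c) (use h f(2) l in auto)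
  moreover have "1 / (2 * (f s * ?l)\<^sup>2) * (2 * f s * f' * ?l\<^sup>2 * t + ((- 2 * (f s)\<^sup>2 * ?l ^ 3) *\<^sub>R y) \<bullet> w)
      = f' / f s * t - ?l * (y \<bullet> w)" for t w
    using l f(2) by (simp add: field_simps power2_eq_square power3_eq_cube)
  moreover have "1 / (2 * (f s * ?l)\<^sup>2) * ((p \<bullet> q) * (- 2 * (f s)\<^sup>2 * ?l ^ 3)) = - (?l * (p \<bullet> q))"
    using l f(2) by (simp add: field_simps power2_eq_square power3_eq_cube)
  ultimately show ?thesis
    by (simp only: scaleR_add_right scaleR_diff_right scaleR_scaleR prod.inject) simp
qed

text \<open>
  At the origin of the stereographic chart the factor is \<open>2\<close> and its differential vanishes, which
  keeps the derivatives of the Christoffel symbols short.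
\<close>

lemma riemann_warped_sphere:
  fixes h :: "(real \<times> 'b::euclidean_space) bilinear_field"
  assumes "open U" "(s, 0) \<in> U"
    and h: "\<forall>x\<in>U. \<forall>u v. h x u v =
      fst u * fst v + (f (fst x) * stereo_factor (snd x))\<^sup>2 * (snd u \<bullet> snd v)"
    and f: "\<forall>x\<in>U. (f has_real_derivative f1 (fst x)) (at (fst x))"
      "\<forall>x\<in>U. f (fst x) \<noteq> 0"
    and f1: "(f1 has_real_derivative f2) (at s)"
  shows "riemann h (s, 0) (a, p) (b, q) (c, r) =
    (- 4 * f s * f2 * (a * (q \<bullet> r) - b * (p \<bullet> r)),
     (f2 / f s * c) *\<^sub>R (a *\<^sub>R q - b *\<^sub>R p)
       + (4 - 4 * (f1 s)\<^sup>2) *\<^sub>R ((q \<bullet> r) *\<^sub>R p - (p \<bullet> r) *\<^sub>R q))"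
proof -
  have [simp]: "f s \<noteq> 0" using f(2) assms(2) by fastforce
  have fs: "(f has_real_derivative f1 s) (at s)" using f(1) assms(2) by fastforce
  let ?\<Gamma> = "\<lambda>b q c r x. (- (f (fst x) * f1 (fst x) * (stereo_factor (snd x))\<^sup>2) * (q \<bullet> r),
    (f1 (fst x) / f (fst x) * b - stereo_factor (snd x) * (snd x \<bullet> q)) *\<^sub>R r
    + (f1 (fst x) / f (fst x) * c - stereo_factor (snd x) * (snd x \<bullet> r)) *\<^sub>R q
    + (stereo_factor (snd x) * (q \<bullet> r)) *\<^sub>R snd x)"
  have \<Gamma>: "christoffel h x (b, q) (c, r) = ?\<Gamma> b q c r x" if "x \<in> U" for x b q c r
    using christoffel_warped_sphere[of U "fst x" "snd x" h f "f1 (fst x)" b q c r] assms(1) h f that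
    by simp
  have d1: "((f \<circ> fst) has_derivative ((\<lambda>t. f1 s * t) \<circ> fst)) (at (s, 0::'b))"
    using fs by (intro diff_chain_at) (auto simp: has_field_derivative_def intro: derivative_eq_intros)
  have d2: "((f1 \<circ> fst) has_derivative ((\<lambda>t. f2 * t) \<circ> fst)) (at (s, 0::'b))"
    using f1 by (intro diff_chain_at) (auto simp: has_field_derivative_def intro: derivative_eq_intros)
  have d3: "((stereo_factor \<circ> snd) has_derivative ((\<lambda>p. 0) \<circ> snd)) (at (s, 0::'b))"
    using has_derivative_stereo_factor[of "0::'b"]
    by (intro diff_chain_at) (auto intro: derivative_eq_intros)
  have [simp]: "stereo_factor (0::'b) = 2" by (simp add: stereo_factor_def)
  note d = d1[unfolded o_def] d2[unfolded o_def] d3[unfolded o_def]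
  have dM: "((\<lambda>x. - (f (fst x) * f1 (fst x) * (stereo_factor (snd x))\<^sup>2)) has_derivative
      (\<lambda>w. - 4 * ((f1 s)\<^sup>2 + f s * f2) * fst w)) (at (s, 0::'b))"
    by (rule has_derivative_eq_rhs, (rule derivative_intros d)+)
      (simp add: fun_eq_iff power2_eq_square algebra_simps)
  have dK: "((\<lambda>x. f1 (fst x) / f (fst x)) has_derivative
      (\<lambda>w. (f2 / f s - (f1 s / f s)\<^sup>2) * fst w)) (at (s, 0::'b))"
    by (rule has_derivative_eq_rhs, rule has_derivative_divide'[OF d(2,1)])
      (simp_all add: fun_eq_iff power2_eq_square field_simps)
  have dL: "((\<lambda>x. stereo_factor (snd x) * (snd x \<bullet> q)) has_derivative (\<lambda>w. 2 * (snd w \<bullet> q))) (at (s, 0::'b))" for q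
    by (auto intro!: derivative_eq_intros d)
  have d\<Gamma>: "frechet_derivative (\<lambda>x. christoffel h x (b, q) (c, r)) (at (s, 0)) (a, p) =
      (- 4 * ((f1 s)\<^sup>2 + f s * f2) * a * (q \<bullet> r),
       ((f2 / f s - (f1 s / f s)\<^sup>2) * a * b - 2 * (p \<bullet> q)) *\<^sub>R r
       + ((f2 / f s - (f1 s / f s)\<^sup>2) * a * c - 2 * (p \<bullet> r)) *\<^sub>R q + (2 * (q \<bullet> r)) *\<^sub>R p)"
    for a p b q c r
  proof -
    have "frechet_derivative (\<lambda>x. christoffel h x (b, q) (c, r)) (at (s, 0)) (a, p)
        = frechet_derivative (?\<Gamma> b q c r) (at (s, 0)) (a, p)"
      by (intro fun_cong[OF frechet_derivative_cong_open[OF assms(1,2)]] \<Gamma>)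
    also have "\<dots> = (- 4 * ((f1 s)\<^sup>2 + f s * f2) * a * (q \<bullet> r),
       ((f2 / f s - (f1 s / f s)\<^sup>2) * a * b - 2 * (p \<bullet> q)) *\<^sub>R r
       + ((f2 / f s - (f1 s / f s)\<^sup>2) * a * c - 2 * (p \<bullet> r)) *\<^sub>R q + (2 * (q \<bullet> r)) *\<^sub>R p)"
      by (rule frechet_derivative_eq[THEN trans],
          (rule has_derivative_Pair has_derivative_add has_derivative_diff has_derivative_mult_left
            has_derivative_scaleR_left has_derivative_scaleR has_derivative_snd has_derivative_ident
            dM dK dL d)+)
        simp
    finally show ?thesis .
  qed
  have \<Gamma>0: "christoffel h (s, 0) (b, q) (c, r) =
      (- 4 * f s * f1 s * (q \<bullet> r), (f1 s / f s) *\<^sub>R (b *\<^sub>R r + c *\<^sub>R q))" for b q c r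
    using \<Gamma>[OF assms(2)] by (simp add: algebra_simps)
  \<comment> \<open>The 4 in the curvature arises as 2 + 2, one half from each of the two
    differentiated Christoffel symbols; this identity matches the two halves of a vector term with
    the whole.\<close>
  have "(t * 4) *\<^sub>R w = (t * 2) *\<^sub>R w + (t * 2) *\<^sub>R w" for t and w :: 'b
    by (simp add: scaleR_add_left[symmetric])
  then show ?thesis
    unfolding riemann_def d\<Gamma> \<Gamma>0
    by (simp add: algebra_simps power2_eq_square inner_commute)
qed

text \<open>The factors 4 are \<open>(stereo_factor 0)^2\<close>, so
  \<open>4 * (q \<bullet> r)\<close> is the round inner product of \<open>q\<close> and
  \<open>r\<close> at the centre of the chart. The radial direction contributes
  \<open>- 4 f f''\<close>; over the sphere directions the trace is closed by Parseval's
  identity.\<close>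

lemma ricci_warped_sphere:
  fixes h :: "(real \<times> 'b::euclidean_space) bilinear_field"
  assumes "open U" "(s, 0) \<in> U"
    and "\<forall>x\<in>U. \<forall>u v. h x u v =
      fst u * fst v + (f (fst x) * stereo_factor (snd x))\<^sup>2 * (snd u \<bullet> snd v)"
    and "\<forall>x\<in>U. (f has_real_derivative f1 (fst x)) (at (fst x))"
      "\<forall>x\<in>U. f (fst x) \<noteq> 0"
    and "(f1 has_real_derivative f2) (at s)"
  shows "ricci h (s, 0) (b, q) (c, r) =
    - 4 * f s * f2 * (q \<bullet> r) - real DIM('b) * (f2 / f s) * (b * c)
    + (4 - 4 * (f1 s)\<^sup>2) * (real DIM('b) - 1) * (q \<bullet> r)"
proof -
  note R = riemann_warped_sphere[OF assms]
  have "riemann h (s, 0) (0, e) (b, q) (c, r) \<bullet> (0, e)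
      = - (f2 / f s * c * b) + (4 - 4 * (f1 s)\<^sup>2) * (q \<bullet> r - (q \<bullet> e) * (r \<bullet> e))" if "e \<in> Basis" for e :: 'b
    using that unfolding R by (simp add: inner_commute algebra_simps)
  then have "(\<Sum>e\<in>Basis. riemann h (s, 0) (0, e) (b, q) (c, r) \<bullet> (0, e))
      = - (real DIM('b) * (f2 / f s * c * b))
        + (4 - 4 * (f1 s)\<^sup>2) * (real DIM('b) * (q \<bullet> r) - (\<Sum>e\<in>Basis. (q \<bullet> e) * (r \<bullet> e)))"
    by (simp add: sum.distrib sum_subtractf sum_distrib_left[symmetric])
  moreover have "(\<Sum>e\<in>Basis. (q \<bullet> e) * (r \<bullet> e)) = q \<bullet> r"
    by (rule euclidean_inner[symmetric])
  moreover have "riemann h (s, 0) (1, 0) (b, q) (c, r) \<bullet> (1, 0) = - 4 * f s * f2 * (q \<bullet> r)"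
    unfolding R by simp
  ultimately show ?thesis
    unfolding ricci_def sum_Basis_real_prod by (simp add: algebra_simps)
qed

text \<open>Write \<open>N\<close> for \<open>DIM('b)\<close>, the dimension of the slices. The
  radial direction gives \<open>- N f'' / f\<close>. Along the sphere the inverse metric
  \<open>1 / (2 f)^2\<close> cancels the factors 4, and each of the \<open>N\<close> directions
  gives \<open>- f'' / f + (N - 1) (1 - f'^2) / f^2\<close>.\<close>

lemma scalar_curvature_warped_sphere:
  fixes h :: "(real \<times> 'b::euclidean_space) bilinear_field"
  assumes "open U" "(s, 0) \<in> U"
    and h: "\<forall>x\<in>U. \<forall>u v. h x u v =
      fst u * fst v + (f (fst x) * stereo_factor (snd x))\<^sup>2 * (snd u \<bullet> snd v)"
    and "\<forall>x\<in>U. (f has_real_derivative f1 (fst x)) (at (fst x))"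
      and f: "\<forall>x\<in>U. f (fst x) \<noteq> 0"
    and "(f1 has_real_derivative f2) (at s)"
  shows "scalar_curvature h (s, 0) =
    real DIM('b) * ((real DIM('b) - 1) * (1 - (f1 s)\<^sup>2) / (f s)\<^sup>2 - 2 * f2 / f s)"
proof -
  note Ric = ricci_warped_sphere[OF assms]
  have [simp]: "f s \<noteq> 0" using f assms(2) by fastforce
  have sharp: "sharp h (s, 0) c = (fst c, (1 / (2 * f s)\<^sup>2) *\<^sub>R snd c)" for c
    using sharp_warped[of h "(s, 0)" "(2 * f s)\<^sup>2" c] h assms(2)
    by (simp add: stereo_factor_def mult.commute)
  have "(\<Sum>e\<in>Basis. \<Sum>e'\<in>Basis. (sharp h (s, 0) (0, e) \<bullet> (0, e')) * ricci h (s, 0) (0, e) (0, e'))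
      = (\<Sum>e\<in>(Basis :: 'b set). 1 / (2 * f s)\<^sup>2 * ricci h (s, 0) (0, e) (0, e))"
  proof (rule sum.cong[OF refl])
    fix e :: 'b assume e: "e \<in> Basis"
    have "(\<Sum>e'\<in>Basis. (sharp h (s, 0) (0, e) \<bullet> (0, e')) * ricci h (s, 0) (0, e) (0, e'))
        = (\<Sum>e'\<in>Basis. if e' = e then 1 / (2 * f s)\<^sup>2 * ricci h (s, 0) (0, e) (0, e) else 0)"
      by (rule sum.cong[OF refl]) (use e in \<open>auto simp: sharp inner_Basis\<close>)
    then show "(\<Sum>e'\<in>Basis. (sharp h (s, 0) (0, e) \<bullet> (0, e')) * ricci h (s, 0) (0, e) (0, e'))
        = 1 / (2 * f s)\<^sup>2 * ricci h (s, 0) (0, e) (0, e)"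
      using e by (simp add: sum.delta)
  qed
  also have "\<dots> = real DIM('b) * (1 / (2 * f s)\<^sup>2 * (- 4 * f s * f2
      + (4 - 4 * (f1 s)\<^sup>2) * (real DIM('b) - 1)))"
    unfolding Ric by simp
  finally have "scalar_curvature h (s, 0) = - (real DIM('b) * (f2 / f s))
      + real DIM('b) * (1 / (2 * f s)\<^sup>2 * (- 4 * f s * f2 + (4 - 4 * (f1 s)\<^sup>2) * (real DIM('b) - 1)))"
    unfolding scalar_curvature_def sum_Basis_real_prod sum.distrib
    by (simp add: sharp Ric)
  then show ?thesis by (simp add: field_simps power2_eq_square)
qed

section \<open>Volumes\<close>

lemma norm_stereo_inv [simp]: "norm (stereo_inv (y :: 'b::euclidean_space)) = 1"
proof -
  have "(1 - y \<bullet> y)\<^sup>2 + 4 * (y \<bullet> y) = (1 + y \<bullet> y)\<^sup>2"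
    by (simp add: power2_eq_square algebra_simps)
  moreover have "1 + y \<bullet> y \<noteq> 0" by (metis add_pos_nonneg inner_ge_zero less_irrefl zero_less_one)
  ultimately have "stereo_inv y \<bullet> stereo_inv y = 1"
    unfolding stereo_inv_def power2_norm_eq_inner
    by (simp add: divide_simps power2_eq_square) (simp add: algebra_simps)
  then show ?thesis by (simp add: norm_eq_sqrt_inner)
qed

definition stereo_inv_deriv :: "'b::euclidean_space \<Rightarrow> 'b \<Rightarrow> real \<times> 'b" where
  "stereo_inv_deriv y p = ((stereo_factor y)\<^sup>2 * (y \<bullet> p),
     stereo_factor y *\<^sub>R p - ((stereo_factor y)\<^sup>2 * (y \<bullet> p)) *\<^sub>R y)"

lemma stereo_inv_eq: "stereo_inv y = (1 - stereo_factor y, stereo_factor y *\<^sub>R y)"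
proof -
  have "1 + y \<bullet> y \<noteq> 0" by (metis add_pos_nonneg inner_ge_zero less_irrefl zero_less_one)
  then show ?thesis
    unfolding stereo_inv_def stereo_factor_def power2_norm_eq_inner by (simp add: field_simps)
qed

lemma has_derivative_stereo_inv: "(stereo_inv has_derivative stereo_inv_deriv y) (at y)"
proof -
  have "((\<lambda>y. (1 - stereo_factor y, stereo_factor y *\<^sub>R y)) has_derivative stereo_inv_deriv y) (at y)"
    by (rule has_derivative_eq_rhs,
        (rule has_derivative_Pair has_derivative_diff has_derivative_const has_derivative_scaleR
          has_derivative_ident has_derivative_stereo_factor)+)
      (simp add: stereo_inv_deriv_def fun_eq_iff)
  then show ?thesis unfolding stereo_inv_eq[symmetric] by simp
qed

text \<open>In terms of \<open>stereo_factor\<close> the projection and its differential are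
  polynomial, and this is the one relation between the factor and \<open>y\<close>. The computations
  of lengths and of tangency below each leave a remainder that it annihilates.\<close>

lemma stereo_factor_eq: "stereo_factor y * (y \<bullet> y) = 2 - stereo_factor y"
proof -
  have "1 + y \<bullet> y \<noteq> 0" by (metis add_pos_nonneg inner_ge_zero less_irrefl zero_less_one)
  then show ?thesis unfolding stereo_factor_def by (simp add: field_simps)
qed

lemma stereo_inv_deriv_inner:
  "stereo_inv_deriv y p \<bullet> stereo_inv_deriv y q = (stereo_factor y)\<^sup>2 * (p \<bullet> q)"
proof -
  let ?l = "stereo_factor y"
  have "stereo_inv_deriv y p \<bullet> stereo_inv_deriv y q
      = ?l\<^sup>2 * (p \<bullet> q) + (y \<bullet> p) * (y \<bullet> q) * ?l ^ 3 * (?l - 2 + ?l * (y \<bullet> y))"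
    unfolding stereo_inv_deriv_def
    by (simp add: inner_commute power2_eq_square power3_eq_cube algebra_simps)
  then show ?thesis by (simp add: stereo_factor_eq)
qed

lemma stereo_inv_deriv_tangent: "stereo_inv_deriv y p \<in> tangent_space (stereo_inv y)"
proof -
  let ?l = "stereo_factor y"
  have "stereo_inv y \<bullet> stereo_inv_deriv y p = ?l\<^sup>2 * (y \<bullet> p) * (2 - ?l - ?l * (y \<bullet> y))"
    unfolding stereo_inv_deriv_def stereo_inv_eq
    by (simp add: inner_commute power2_eq_square algebra_simps)
  then show ?thesis by (simp add: stereo_factor_eq tangent_space_def)
qed

lemma inj_stereo_inv: "inj (stereo_inv :: 'b::euclidean_space \<Rightarrow> _)"
proof (rule injI)
  fix x y :: 'b assume "stereo_inv x = stereo_inv y"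
  then have "stereo_factor x = stereo_factor y" "stereo_factor x *\<^sub>R x = stereo_factor y *\<^sub>R y"
    unfolding stereo_inv_eq by auto
  then show "x = y" using stereo_factor_pos[of y] by auto
qed

lemma stereo_inv_bilinear_pullback:
  assumes "\<And>u v. \<lbrakk>u \<in> tangent_space (stereo_inv y); v \<in> tangent_space (stereo_inv y)\<rbrakk>
      \<Longrightarrow> h (stereo_inv y) u v = c * (u \<bullet> v)"
  shows "pullback stereo_inv h y p q = c * (stereo_factor y)\<^sup>2 * (p \<bullet> q)"
  unfolding pullback_def
  by (simp add: frechet_derivative_eq[OF has_derivative_stereo_inv] assms stereo_inv_deriv_tangent
      stereo_inv_deriv_inner)

text \<open>The Gram matrix in the stereographic chart is the scalar matrix
  \<open>(c * stereo_factor y)^2\<close>, so the volume density is the power \<open>CARD('k)\<close>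
  of \<open>c * stereo_factor y\<close>. The remaining integral is the volume of the unit
  sphere.\<close>

lemma sphere_volume_conformal:
  fixes h :: "(real \<times> (real^'k)) bilinear_field"
  assumes "\<And>\<theta> u v. \<lbrakk>\<theta> \<in> unit_sphere; u \<in> tangent_space \<theta>; v \<in> tangent_space \<theta>\<rbrakk>
      \<Longrightarrow> h \<theta> u v = c\<^sup>2 * (u \<bullet> v)"
    and "0 \<le> c"
  shows "sphere_volume h
    = ennreal (c ^ CARD('k)) * (\<integral>\<^sup>+ y. ennreal (stereo_factor (y :: real^'k) ^ CARD('k)) \<partial>lborel)"
proof -
  have "sqrt (det (\<chi> i j. pullback stereo_inv h y (axis i 1) (axis j 1)))
      = c ^ CARD('k) * stereo_factor y ^ CARD('k)" for y :: "real^'k"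
  proof -
    have "pullback stereo_inv h y (axis i 1) (axis j 1) = (if i = j then (c * stereo_factor y)\<^sup>2 else 0)" for i j
      using stereo_inv_bilinear_pullback[of y h "c\<^sup>2" "axis i 1" "axis j 1"] assms(1)[of "stereo_inv y"]
      by (auto simp: inner_axis_axis power_mult_distrib)
    then have "det (\<chi> i j. pullback stereo_inv h y (axis i 1) (axis j 1))
        = (c * stereo_factor y)\<^sup>2 ^ CARD('k)"
      by (subst det_diagonal) auto
    also have "\<dots> = ((c * stereo_factor y) ^ CARD('k))\<^sup>2"
      by (simp add: power_mult[symmetric] mult.commute)
    finally show ?thesis
      using assms(2) stereo_factor_pos[of y] by (simp add: real_sqrt_mult power_mult_distrib)
  qed
  then have "sphere_volume h = (\<integral>\<^sup>+ y. ennreal (c ^ CARD('k)) * ennreal (stereo_factor (y::real^'k) ^ CARD('k)) \<partial>lborel)"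
    unfolding sphere_volume_def using assms(2)
    by (simp add: ennreal_mult less_imp_le[OF stereo_factor_pos])
  also have "\<dots> = ennreal (c ^ CARD('k)) * (\<integral>\<^sup>+ y. ennreal (stereo_factor (y :: real^'k) ^ CARD('k)) \<partial>lborel)"
    by (rule nn_integral_cmult) (simp add: stereo_factor_def)
  finally show ?thesis .
qed

text \<open>
  Expanding \<open>(1 + |y|^2)^k\<close> dominates the product of the \<open>1 + y_i^2\<close>, so the integral splits into
  one-dimensional integrals.
\<close>

lemma stereo_factor_integral_finite:
  "(\<integral>\<^sup>+ y. ennreal (stereo_factor (y :: 'b::euclidean_space) ^ DIM('b)) \<partial>lborel) < \<infinity>"
proof -
  let ?I = "\<integral>\<^sup>+ x. ennreal (2 * inverse (1 + x\<^sup>2)) \<partial>(lborel :: real measure)"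
  have "integrable lborel (\<lambda>x::real. 2 * inverse (1 + x\<^sup>2))"
    using integrable_inverse_1_plus_square
    by (intro integrable_mult_right) (simp add: set_integrable_def einterval_def)
  then have "?I < \<infinity>"
    by (subst (asm) integrable_iff_bounded) (simp add: norm_mult)
  have "(\<integral>\<^sup>+ y. ennreal (stereo_factor (y :: 'b) ^ DIM('b)) \<partial>lborel)
      \<le> (\<integral>\<^sup>+ y. (\<Prod>b\<in>Basis. ennreal (2 * inverse (1 + (y \<bullet> b :: real)\<^sup>2))) \<partial>(lborel :: 'b measure))"
  proof (rule nn_integral_mono)
    fix y :: 'b
    have "stereo_factor y ^ DIM('b) = (\<Prod>b\<in>(Basis::'b set). stereo_factor y)" by simp
    also have "\<dots> \<le> (\<Prod>b\<in>Basis. 2 * inverse (1 + (y \<bullet> b)\<^sup>2))"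
    proof (rule prod_mono)
      fix b :: 'b assume "b \<in> Basis"
      then have "(y \<bullet> b)\<^sup>2 \<le> y \<bullet> y"
        using Basis_le_norm[of b y] by (metis abs_le_square_iff abs_norm_cancel power2_norm_eq_inner)
      then have "2 / (1 + y \<bullet> y) \<le> 2 / (1 + (y \<bullet> b)\<^sup>2)"
        by (intro divide_left_mono) (auto intro!: mult_pos_pos add_pos_nonneg)
      then show "0 \<le> stereo_factor y \<and> stereo_factor y \<le> 2 * inverse (1 + (y \<bullet> b)\<^sup>2)"
        using stereo_factor_pos[of y] unfolding stereo_factor_def by (simp add: divide_inverse)
    qed
    finally show "ennreal (stereo_factor y ^ DIM('b)) \<le> (\<Prod>b\<in>Basis. ennreal (2 * inverse (1 + (y \<bullet> b)\<^sup>2)))"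
      by (subst prod_ennreal) (auto intro!: ennreal_leI)
  qed
  also have "\<dots> = (\<Prod>b\<in>(Basis :: 'b set). ?I)"
    by (rule nn_integral_lborel_prod) auto
  also have "\<dots> < \<infinity>"
    using \<open>?I < \<infinity>\<close> by (simp add: power_less_top_ennreal)
  finally show ?thesis .
qed

text \<open>Positivity, together with finiteness, permits cancelling the volume of the unit sphere
  from an inequality in \<open>ennreal\<close>.\<close>

lemma stereo_factor_integral_pos:
  "(\<integral>\<^sup>+ y. ennreal (stereo_factor (y :: 'b::euclidean_space) ^ k) \<partial>lborel) > 0"
proof -
  have "{y :: 'b. ennreal (stereo_factor y ^ k) \<noteq> 0} = UNIV"
    using zero_less_power[OF stereo_factor_pos] by (auto simp: ennreal_eq_0_iff not_le)
  moreover have "(\<lambda>y :: 'b. ennreal (stereo_factor y ^ k)) \<in> borel_measurable lborel"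
    by (simp add: stereo_factor_def)
  ultimately have "(\<integral>\<^sup>+ y. ennreal (stereo_factor (y :: 'b) ^ k) \<partial>lborel) \<noteq> 0"
    by (simp add: nn_integral_0_iff emeasure_lborel_UNIV)
  then show ?thesis by (simp add: zero_less_iff_neq_zero)
qed

section \<open>Spheres and polar coordinates\<close>

text \<open>The orthogonal projection onto the tangent space at \<open>sgn x\<close>, scaled by
  \<open>1 / norm x\<close>; on tangent vectors at a unit vector it is the identity.\<close>

definition sgn_deriv :: "'a::euclidean_space \<Rightarrow> 'a \<Rightarrow> 'a" where
  "sgn_deriv x v = (1 / norm x) *\<^sub>R (v - (sgn x \<bullet> v) *\<^sub>R sgn x)"

lemma has_derivative_sgn:
  assumes "x \<noteq> 0"
  shows "(sgn has_derivative sgn_deriv x) (at x)"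
proof -
  have "(norm has_derivative (\<lambda>v. sgn x \<bullet> v)) (at x)"
    using has_derivative_norm[OF assms] by (simp add: inner_commute)
  then have "((\<lambda>x. x /\<^sub>R norm x) has_derivative sgn_deriv x) (at x)"
    using assms
    by (auto intro!: derivative_eq_intros
        simp: sgn_deriv_def fun_eq_iff sgn_div_norm algebra_simps divide_inverse)
  then show ?thesis
    by (simp add: sgn_div_norm[abs_def])
qed

lemma norm_eq_1_imp_sgn: "norm x = 1 \<Longrightarrow> sgn x = x"
  by (simp add: sgn_div_norm)

lemma sgn_deriv_unit:
  assumes "norm p = 1" "v \<in> tangent_space p"
  shows "sgn_deriv p v = v"
  using assms by (simp add: sgn_deriv_def norm_eq_1_imp_sgn tangent_space_def)

lemma sgn_in_unit_sphere: "x \<noteq> 0 \<Longrightarrow> sgn x \<in> unit_sphere"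
  by (simp add: norm_sgn)

lemma smooth_on_sphere_has_derivative:
  assumes "smooth_on_sphere F" "x \<noteq> 0"
  shows "((\<lambda>x. F (sgn x)) has_derivative frechet_derivative (\<lambda>x. F (sgn x)) (at x)) (at x)"
proof -
  have "Ck_on (Suc 0) (- {0}) (\<lambda>x. F (sgn x))"
    using assms(1) unfolding smooth_on_sphere_def smooth_on_def by blast
  from Ck_on_has_derivative[OF this, of x] assms(2) show ?thesis by simp
qed

text \<open>Because \<open>sgn\<close> is idempotent, the extension of \<open>F\<close> factors once
  more through \<open>sgn\<close>. This moves a differential at an arbitrary nonzero point to the
  sphere, where metrics are meaningful.\<close>

lemma sgn_deriv_chain:
  assumes "smooth_on_sphere F" "x \<noteq> 0"
  shows "frechet_derivative (\<lambda>x. F (sgn x)) (at x) v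
    = frechet_derivative (\<lambda>x. F (sgn x)) (at (sgn x)) (sgn_deriv x v)"
proof (rule frechet_derivative_eq)
  have "sgn x \<noteq> 0" using assms(2) by (simp add: sgn_zero_iff)
  have sgn_sgn: "sgn (sgn y) = sgn y" for y :: 'a by (cases "y = 0") (simp_all add: norm_eq_1_imp_sgn norm_sgn)
  from has_derivative_compose[OF has_derivative_sgn[OF assms(2)] smooth_on_sphere_has_derivative[OF assms(1) \<open>sgn x \<noteq> 0\<close>]]
  show "((\<lambda>x. F (sgn x)) has_derivative
      (\<lambda>v. frechet_derivative (\<lambda>x. F (sgn x)) (at (sgn x)) (sgn_deriv x v))) (at x)"
    by (simp add: sgn_sgn)
qed

section \<open>Differentials of diffeomorphisms of the sphere\<close>

lemma norm_const_imp_inner_derivative_eq_0: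
  fixes F :: "'a::real_normed_vector \<Rightarrow> 'b::real_inner"
  assumes "(F has_derivative F') (at x)" "open U" "x \<in> U" "\<And>y. y \<in> U \<Longrightarrow> norm (F y) = 1"
  shows "F x \<bullet> F' v = 0"
proof -
  have "((\<lambda>y. F y \<bullet> F y) has_derivative (\<lambda>v. F x \<bullet> F' v + F' v \<bullet> F x)) (at x)"
    by (intro has_derivative_inner assms(1))
  moreover have "((\<lambda>y. F y \<bullet> F y) has_derivative (\<lambda>v. 0)) (at x)"
    by (rule has_derivative_transform_within_open[OF has_derivative_const assms(2,3), of 1])
      (simp add: assms(4) norm_eq_1[symmetric])
  ultimately have "(\<lambda>v. F x \<bullet> F' v + F' v \<bullet> F x) = (\<lambda>v. 0)"
    by (rule has_derivative_unique)
  then have "F x \<bullet> F' v + F' v \<bullet> F x = 0" by (rule fun_cong)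
  then show ?thesis by (simp add: inner_commute)
qed

lemma sphere_diffeo_in_sphere: "sphere_diffeo F \<Longrightarrow> p \<in> unit_sphere \<Longrightarrow> F p \<in> unit_sphere"
  unfolding sphere_diffeo_def by (blast dest: bij_betwE)

lemma sphere_diffeo_deriv_tangent:
  assumes "sphere_diffeo F" "p \<in> unit_sphere"
  shows "frechet_derivative (\<lambda>x. F (sgn x)) (at p) v \<in> tangent_space (F p)"
proof -
  have p: "p \<noteq> 0" "sgn p = p" using assms(2) by (auto simp: norm_eq_1_imp_sgn)
  have "smooth_on_sphere F" using assms(1) unfolding sphere_diffeo_def by blast
  from norm_const_imp_inner_derivative_eq_0[OF smooth_on_sphere_has_derivative[OF this p(1)], of "- {0}"]
  have "F (sgn p) \<bullet> frechet_derivative (\<lambda>x. F (sgn x)) (at p) v = 0"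
    using p sphere_diffeo_in_sphere[OF assms(1) sgn_in_unit_sphere] by auto
  then show ?thesis using p by (simp add: tangent_space_def)
qed

text \<open>Composing the extensions of \<open>F\<close> and \<open>H\<close> gives
  \<open>sgn\<close> near \<open>p\<close>, and the differential of \<open>sgn\<close> fixes tangent
  vectors.\<close>

lemma sphere_diffeo_deriv_inverse:
  assumes "smooth_on_sphere F" "smooth_on_sphere H" "\<And>q. q \<in> unit_sphere \<Longrightarrow> F q \<in> unit_sphere"
    and "\<And>q. q \<in> unit_sphere \<Longrightarrow> H (F q) = q"
    and "p \<in> unit_sphere" "v \<in> tangent_space p"
  shows "frechet_derivative (\<lambda>x. H (sgn x)) (at (F p)) (frechet_derivative (\<lambda>x. F (sgn x)) (at p) v) = v"
proof -
  have p: "p \<noteq> 0" "sgn p = p" "norm p = 1" using assms(5) by (auto simp: norm_eq_1_imp_sgn)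
  have "F p \<noteq> 0" using assms(3)[OF assms(5)] by auto
  let ?d = "\<lambda>v. frechet_derivative (\<lambda>x. H (sgn x)) (at (F p)) (frechet_derivative (\<lambda>x. F (sgn x)) (at p) v)"
  have "((\<lambda>x. H (sgn (F (sgn x)))) has_derivative ?d) (at p)"
    using has_derivative_compose[OF smooth_on_sphere_has_derivative[OF assms(1) p(1)],
        of "\<lambda>x. H (sgn x)"] smooth_on_sphere_has_derivative[OF assms(2) \<open>F p \<noteq> 0\<close>] p(2) by simp
  moreover have "((\<lambda>x. H (sgn (F (sgn x)))) has_derivative sgn_deriv p) (at p)"
  proof (rule has_derivative_transform_within_open[OF has_derivative_sgn[OF p(1)], of "- {0}"])
    show "sgn x = H (sgn (F (sgn x)))" if "x \<in> - {0}" for x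
      using assms(3,4)[OF sgn_in_unit_sphere, of x] that by (simp add: norm_eq_1_imp_sgn)
  qed (use p in auto)
  ultimately have "?d = sgn_deriv p" by (rule has_derivative_unique)
  then show ?thesis using sgn_deriv_unit[OF p(3) assms(6)] by metis
qed

text \<open>Needed wherever a differential vanishes: at the collapsed ends, and on the kernel of a
  would-be chart.\<close>

lemma riemannian_metric_zero:
  assumes "riemannian_metric g" "p \<in> unit_sphere"
  shows "g p 0 0 = 0"
proof -
  have "0 \<in> tangent_space p" by (simp add: tangent_space_def)
  then have "g p (0 *\<^sub>R 0) 0 = 0 * g p 0 0"
    using assms unfolding riemannian_metric_def by blast
  then show ?thesis by simp
qed

lemma norm_polar [simp]: "norm \<theta> = 1 \<Longrightarrow> norm (polar D (s, \<theta>)) = 1"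
  by (simp add: polar_def norm_Pair power_mult_distrib)

lemma has_derivative_polar:
  "(polar D has_derivative (\<lambda>w. (- (sin (pi * s / D) * (pi / D * fst w)),
     (cos (pi * s / D) * (pi / D * fst w)) *\<^sub>R \<theta> + sin (pi * s / D) *\<^sub>R snd w))) (at (s, \<theta>))"
proof -
  define c where "c = pi / D"
  have polar: "polar D = (\<lambda>x. (cos (c * fst x), sin (c * fst x) *\<^sub>R snd x))"
    by (simp add: polar_def fun_eq_iff c_def)
  have c: "pi * s / D = c * s" by (simp add: c_def)
  show ?thesis
    unfolding polar c c_def[symmetric] by (auto intro!: derivative_eq_intros)
qed

lemma polar_inj:
  assumes "0 < D" "s \<in> {0<..<D}" "t \<in> {0<..<D}" "polar D (s, \<theta>) = polar D (t, \<eta>)"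
  shows "s = t \<and> \<theta> = \<eta>"
proof -
  have rng: "0 < pi * r / D \<and> pi * r / D < pi" if "r \<in> {0<..<D}" for r
    using assms(1) that by (auto simp: field_simps)
  have c: "cos (pi * s / D) = cos (pi * t / D)"
    and e: "sin (pi * s / D) *\<^sub>R \<theta> = sin (pi * t / D) *\<^sub>R \<eta>"
    using assms(4) by (simp_all add: polar_def)
  have "pi * s / D = pi * t / D"
    using c rng[OF assms(2)] rng[OF assms(3)] by (metis cos_inj_pi less_imp_le)
  then have "s = t" using assms(1) by simp
  moreover have "sin (pi * t / D) \<noteq> 0" using rng[OF assms(3)] sin_gt_zero by fastforce
  ultimately show ?thesis using e by simp
qed

section \<open>Rotationally symmetric metrics\<close>

lemma warped_pullback_eq:
  assumes "rotationally_symmetric_via D f \<psi> g" "s \<in> {0<..<D}" "\<theta> \<in> unit_sphere"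
    "v \<in> tangent_space \<theta>" "w \<in> tangent_space \<theta>"
  shows "g (\<psi> (polar D (s, \<theta>)))
      (frechet_derivative (\<lambda>x. \<psi> (sgn x)) (at (polar D (s, \<theta>))) (frechet_derivative (polar D) (at (s, \<theta>)) (a, v)))
      (frechet_derivative (\<lambda>x. \<psi> (sgn x)) (at (polar D (s, \<theta>))) (frechet_derivative (polar D) (at (s, \<theta>)) (b, w)))
    = a * b + (f s)\<^sup>2 * (v \<bullet> w)"
proof -
  have "pullback (polar D) (sphere_pullback \<psi> g) (s, \<theta>) (a, v) (b, w)
      = a * b + (f s)\<^sup>2 * round_metric \<theta> v w"
    using assms unfolding rotationally_symmetric_via_def by blast
  moreover have "sgn (polar D (s, \<theta>)) = polar D (s, \<theta>)"
    using assms(3) by (simp add: norm_eq_1_imp_sgn)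
  ultimately show ?thesis
    unfolding pullback_def sphere_pullback_def round_metric_def by simp
qed

text \<open>One chain rule for all parametrizations \<open>G\<close> of the pair
  \<open>(s, \<theta>)\<close>: the slices use it with \<open>s\<close> fixed, the polar chart with
  \<open>\<theta>\<close> in stereographic coordinates.\<close>

lemma has_derivative_diffeo_polar:
  assumes "sphere_diffeo \<psi>" "norm \<theta> = 1" "(G has_derivative G') (at x)" "G x = (s, \<theta>)"
  shows "((\<lambda>x. \<psi> (sgn (polar D (G x)))) has_derivative
    (\<lambda>v. frechet_derivative (\<lambda>x. \<psi> (sgn x)) (at (polar D (s, \<theta>)))
      (frechet_derivative (polar D) (at (s, \<theta>)) (G' v)))) (at x)"
proof -
  have "polar D differentiable (at (s, \<theta>))"
    using has_derivative_polar unfolding differentiable_def by blast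
  then have p: "(polar D has_derivative frechet_derivative (polar D) (at (G x))) (at (G x))"
    using frechet_derivative_works assms(4) by metis
  have "polar D (G x) \<noteq> 0" using norm_polar[OF assms(2), of D s] assms(4) by auto
  moreover have "smooth_on_sphere \<psi>" using assms(1) unfolding sphere_diffeo_def by blast
  ultimately have "((\<lambda>x. \<psi> (sgn x)) has_derivative frechet_derivative (\<lambda>x. \<psi> (sgn x)) (at (polar D (G x))))
      (at (polar D (G x)))"
    by (intro smooth_on_sphere_has_derivative)
  from has_derivative_compose[OF has_derivative_compose[OF assms(3) p] this]
  show ?thesis unfolding assms(4) .
qed

text \<open>Inside the interval this is the warped form with vanishing radial components. At an end
  the parametrization is constant, so its differential vanishes, in agreement with
  \<open>f s = 0\<close>.\<close>

lemma slice_metric_eq: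
  assumes rs: "rotationally_symmetric_via D f \<psi> g" and g: "riemannian_metric g"
    and s: "s \<in> {0..D}" and "\<theta> \<in> unit_sphere" "u \<in> tangent_space \<theta>" "v \<in> tangent_space \<theta>"
  shows "sphere_pullback (\<lambda>\<theta>. \<psi> (polar D (s, \<theta>))) g \<theta> u v = (f s)\<^sup>2 * (u \<bullet> v)"
proof -
  have \<theta>: "norm \<theta> = 1" "\<theta> \<noteq> 0" "sgn \<theta> = \<theta>" using assms(4) by (auto simp: norm_eq_1_imp_sgn)
  have \<psi>: "sphere_diffeo \<psi>" and D: "0 < D" "f 0 = 0" "f D = 0"
    using rs unfolding rotationally_symmetric_via_def warping_function_def by auto
  show ?thesis
  proof (cases "s \<in> {0<..<D}")
    case True
    have "((\<lambda>x. (s, sgn x)) has_derivative (\<lambda>v. (0, sgn_deriv \<theta> v))) (at \<theta>)"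
      by (intro has_derivative_Pair has_derivative_const has_derivative_sgn \<theta>)
    from has_derivative_diffeo_polar[OF \<psi> \<theta>(1) this]
    have "((\<lambda>x. \<psi> (sgn (polar D (s, sgn x)))) has_derivative (\<lambda>v. frechet_derivative (\<lambda>x. \<psi> (sgn x))
        (at (polar D (s, \<theta>))) (frechet_derivative (polar D) (at (s, \<theta>)) (0, sgn_deriv \<theta> v)))) (at \<theta>)"
      using \<theta>(3) by simp
    from this have "((\<lambda>x. \<psi> (polar D (s, sgn x))) has_derivative (\<lambda>v. frechet_derivative (\<lambda>x. \<psi> (sgn x))
        (at (polar D (s, \<theta>))) (frechet_derivative (polar D) (at (s, \<theta>)) (0, sgn_deriv \<theta> v)))) (at \<theta>)"
      by (rule has_derivative_transform_within_open[where s = "- {0}"])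
        (use \<theta> in \<open>auto simp: norm_eq_1_imp_sgn norm_sgn\<close>)
    note d = frechet_derivative_eq[OF this]
    show ?thesis
      unfolding sphere_pullback_def pullback_def d sgn_deriv_unit[OF \<theta>(1) assms(5)]
        sgn_deriv_unit[OF \<theta>(1) assms(6)] \<theta>(3)
      using warped_pullback_eq[OF rs True assms(4-6), of 0 0] by simp
  next
    case False
    then have "s = 0 \<or> s = D" using s by auto
    then have "f s = 0" and "polar D (s, \<eta>) = (cos (pi * s / D), 0)" for \<eta> :: 'a
      using D by (auto simp: polar_def)
    then have "frechet_derivative (\<lambda>x. \<psi> (polar D (s, sgn x))) (at \<theta>) w = 0" for w
      by (intro frechet_derivative_eq) simp
    moreover have "\<psi> (polar D (s, \<theta>)) \<in> unit_sphere"
      by (rule sphere_diffeo_in_sphere[OF \<psi>]) (simp add: \<theta>(1))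
    ultimately show ?thesis
      using riemannian_metric_zero[OF g] \<open>f s = 0\<close>
      unfolding sphere_pullback_def pullback_def \<theta>(3) by simp
  qed
qed

section \<open>The warping function and the width\<close>

lemma warping_nonneg:
  assumes "warping_function D f" "s \<in> {0..D}"
  shows "0 \<le> f s"
proof (cases "s \<in> {0<..<D}")
  case True
  then show ?thesis using assms(1) unfolding warping_function_def by (simp add: less_imp_le)
next
  case False
  then have "s = 0 \<or> s = D" using assms(2) by auto
  then show ?thesis using assms(1) unfolding warping_function_def by auto
qed

lemma deriv_within_works:
  assumes "0 < D" "s \<in> {0..D}" "h differentiable (at s within {0..D})"
  shows "(h has_real_derivative deriv_within {0..D} h s) (at s within {0..D})"
proof -
  have "(h has_vector_derivative deriv_within {0..D} h s) (at s within {0..D})"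
    unfolding deriv_within_def using assms(3) by (simp add: vector_derivative_works)
  then show ?thesis
    by (simp add: has_real_derivative_iff_has_vector_derivative)
qed

lemma warping_function_derivatives:
  assumes "warping_function D f" "s \<in> {0..D}"
  shows "(f has_real_derivative deriv_within {0..D} f s) (at s within {0..D})"
    and "(deriv_within {0..D} f has_real_derivative deriv_within {0..D} (deriv_within {0..D} f) s)
      (at s within {0..D})"
proof -
  have "0 < D" and d: "(deriv_within {0..D} ^^ k) f differentiable (at s within {0..D})" for k
    using assms unfolding warping_function_def by blast+
  show "(f has_real_derivative deriv_within {0..D} f s) (at s within {0..D})"
    using deriv_within_works[OF \<open>0 < D\<close> assms(2)] d[of 0] by simp
  show "(deriv_within {0..D} f has_real_derivative deriv_within {0..D} (deriv_within {0..D} f) s)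
      (at s within {0..D})"
    using deriv_within_works[OF \<open>0 < D\<close> assms(2)] d[of 1] by simp
qed

lemma width_ge_imp_large:
  fixes g :: "(real \<times> (real \<times> (real^'k))) bilinear_field"
  assumes rs: "rotationally_symmetric_via D f \<psi> g" and g: "riemannian_metric g"
    and W: "width D \<psi> g \<ge> sphere_volume (round_metric :: (real \<times> (real^'k)) bilinear_field)"
  shows "\<exists>s\<in>{0..D}. f s \<ge> 1"
proof (rule ccontr)
  assume *: "\<not> ?thesis"
  define V where "V = (\<integral>\<^sup>+ y. ennreal (stereo_factor (y :: real^'k) ^ CARD('k)) \<partial>lborel)"
  have V: "V < \<infinity>" "V > 0"
    unfolding V_def using stereo_factor_integral_finite[where 'b = "real^'k"] stereo_factor_integral_pos
    by simp_all
  have wf: "warping_function D f" using rs unfolding rotationally_symmetric_via_def by blast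
  have "0 < D" using wf unfolding warping_function_def by blast
  have "continuous_on {0..D} f"
    using warping_function_derivatives(1)[OF wf] by (rule DERIV_continuous_on)
  \<comment> \<open>That the maximum is attained makes the bound strict: \<open>f s < 1\<close> at
    every \<open>s\<close> would not by itself keep the supremum of the volumes below
    \<open>V\<close>.\<close>
  then obtain s0 where s0: "s0 \<in> {0..D}" "\<And>s. s \<in> {0..D} \<Longrightarrow> f s \<le> f s0"
    using continuous_attains_sup[of "{0..D}" f] \<open>0 < D\<close> by auto
  have "f s0 < 1" using * s0(1) by force
  have slice: "slice_volume D \<psi> g s = ennreal (f s ^ CARD('k)) * V" if "s \<in> {0..D}" for s
    unfolding slice_volume_def V_def
    by (rule sphere_volume_conformal[OF slice_metric_eq[OF rs g that] warping_nonneg[OF wf that]])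
  have "sphere_volume (round_metric :: (real \<times> (real^'k)) bilinear_field) = ennreal (1 ^ CARD('k)) * V"
    unfolding V_def by (rule sphere_volume_conformal) (simp_all add: round_metric_def)
  then have "V \<le> width D \<psi> g" using W by simp
  also have "\<dots> \<le> ennreal (f s0 ^ CARD('k)) * V"
    unfolding width_def
    by (intro SUP_least) (auto simp: slice intro!: mult_right_mono ennreal_leI power_mono s0(2) warping_nonneg[OF wf])
  finally have le: "V \<le> ennreal (f s0 ^ CARD('k)) * V" .
  have "f s0 ^ CARD('k) < 1"
    using \<open>f s0 < 1\<close> warping_nonneg[OF wf s0(1)] by (intro power_less_one_iff[THEN iffD2]) auto
  \<comment> \<open>As a positive real, \<open>V\<close> can be cancelled, which contradicts a
    factor below 1.\<close>
  obtain r where r: "V = ennreal r" "0 < r" using V by (cases V) (auto simp: ennreal_less_zero_iff)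
  have "r \<le> f s0 ^ CARD('k) * r"
    using le r warping_nonneg[OF wf s0(1)] by (simp add: ennreal_mult[symmetric])
  then show False using r(2) \<open>f s0 ^ CARD('k) < 1\<close> by simp
qed

text \<open>The \<open>sgn\<close> fixes the unit vector it is applied to; it is present because
  smoothness and differentials of \<open>\<psi>\<close> are expressed through
  \<open>x \<mapsto> \<psi> (sgn x)\<close>.\<close>

definition polar_chart :: "real \<Rightarrow> (real \<times> (real \<times> 'b) \<Rightarrow> real \<times> (real \<times> 'b))
    \<Rightarrow> real \<times> 'b::euclidean_space \<Rightarrow> real \<times> (real \<times> 'b)" where
  "polar_chart D \<psi> x = \<psi> (sgn (polar D (fst x, stereo_inv (snd x))))"

text \<open>
  Scaling by \<open>1 + |y|^2\<close> does not change \<^term>\<open>sgn\<close> and removes the denominators of the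
  stereographic projection.
\<close>

lemma smooth_polar_chart:
  fixes \<psi> :: "real \<times> (real \<times> 'b::euclidean_space) \<Rightarrow> real \<times> (real \<times> 'b)"
  assumes "sphere_diffeo \<psi>" "open U"
  shows "smooth_on U (polar_chart D \<psi>)"
  unfolding smooth_on_def
proof
  fix k
  let ?G = "\<lambda>x :: real \<times> 'b. ((1 + snd x \<bullet> snd x) *\<^sub>R cos (fst x *\<^sub>R (pi / D)),
      sin (fst x *\<^sub>R (pi / D)) *\<^sub>R (snd x \<bullet> snd x - 1, 2 *\<^sub>R snd x))"
  have pos: "0 < 1 + y \<bullet> y" for y :: 'b by (simp add: add_pos_nonneg)
  have G: "?G x = (1 + snd x \<bullet> snd x) *\<^sub>R polar D (fst x, stereo_inv (snd x))" for x
  proof -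
    have "1 + snd x \<bullet> snd x \<noteq> 0" using pos[of "snd x"] by simp
    then show ?thesis
      unfolding polar_def stereo_inv_def power2_norm_eq_inner
      by (simp add: mult.commute add.commute)
  qed
  have eq: "polar_chart D \<psi> x = \<psi> (sgn (?G x))" for x
    unfolding G polar_chart_def using pos[of "snd x"] by (simp add: sgn_scaleR)
  have nz: "?G x \<noteq> 0" for x
  proof -
    have "polar D (fst x, stereo_inv (snd x)) \<noteq> 0"
      using norm_polar[OF norm_stereo_inv] by (metis norm_zero zero_neq_one)
    then show ?thesis unfolding G using pos[of "snd x"] by simp
  qed
  have im: "?G ` U \<subseteq> - {0}"
    by (rule image_subsetI) (unfold Compl_iff singleton_iff, rule nz)
  have G_smooth: "Ck_on k U ?G"
  proof -
    note U = \<open>open U\<close>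
    have snd: "Ck_on k U snd" and fst: "Ck_on k U (\<lambda>x. fst x *\<^sub>R (pi / D))"
      by (intro Ck_on_linear U bounded_linear_snd
          bounded_linear_scaleR_left[THEN bounded_linear_compose, OF bounded_linear_fst])+
    have sq: "Ck_on k U (\<lambda>x :: real \<times> 'b. snd x \<bullet> snd x)"
      by (rule Ck_on_bilinear[OF U bounded_bilinear_inner snd snd])
    have trig: "Ck_on k U (\<lambda>x. sin (fst x *\<^sub>R (pi / D)))" "Ck_on k U (\<lambda>x. cos (fst x *\<^sub>R (pi / D)))"
      by (rule Ck_on_compose[OF U _ Ck_on_sin fst] Ck_on_compose[OF U _ Ck_on_cos fst], simp)+
    have "Ck_on k U (\<lambda>x :: real \<times> 'b. 1 + snd x \<bullet> snd x)" "Ck_on k U (\<lambda>x :: real \<times> 'b. snd x \<bullet> snd x + - 1)"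
      by (rule Ck_on_add[OF U Ck_on_const sq] Ck_on_add[OF U sq Ck_on_const])+
    then have "Ck_on k U (\<lambda>x. ((1 + snd x \<bullet> snd x) *\<^sub>R cos (fst x *\<^sub>R (pi / D)),
      sin (fst x *\<^sub>R (pi / D)) *\<^sub>R (snd x \<bullet> snd x + - 1, 2 *\<^sub>R snd x)))"
      by (intro Ck_on_Pair Ck_on_bilinear[OF U bounded_bilinear_scaleR] U trig Ck_on_const snd)
    then show ?thesis by simp
  qed
  have "Ck_on k (- {0}) (\<lambda>z. \<psi> (sgn z))"
    using assms(1) unfolding sphere_diffeo_def smooth_on_sphere_def smooth_on_def by blast
  from Ck_on_compose[OF assms(2) im this G_smooth] show "Ck_on k U (polar_chart D \<psi>)"
    unfolding eq[abs_def] .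
qed

lemma polar_chart_metric:
  assumes rs: "rotationally_symmetric_via D f \<psi> g" and x: "fst x \<in> {0<..<D}"
  shows "pullback (polar_chart D \<psi>) g x u v
    = fst u * fst v + (f (fst x) * stereo_factor (snd x))\<^sup>2 * (snd u \<bullet> snd v)"
proof -
  have \<psi>: "sphere_diffeo \<psi>" using rs unfolding rotationally_symmetric_via_def by blast
  have "((stereo_inv \<circ> snd) has_derivative (stereo_inv_deriv (snd x) \<circ> snd)) (at x)"
    using has_derivative_stereo_inv[of "snd x"]
    by (intro diff_chain_at) (auto intro: derivative_eq_intros)
  then have "((\<lambda>x. (fst x, stereo_inv (snd x))) has_derivative
      (\<lambda>w. (fst w, stereo_inv_deriv (snd x) (snd w)))) (at x)"
    unfolding o_def by (intro has_derivative_Pair has_derivative_fst has_derivative_ident)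
  from has_derivative_diffeo_polar[OF \<psi> norm_stereo_inv this refl]
  have "(polar_chart D \<psi> has_derivative (\<lambda>w. frechet_derivative (\<lambda>x. \<psi> (sgn x))
      (at (polar D (fst x, stereo_inv (snd x)))) (frechet_derivative (polar D) (at (fst x, stereo_inv (snd x)))
        (fst w, stereo_inv_deriv (snd x) (snd w))))) (at x)"
    unfolding polar_chart_def[abs_def] .
  note d = frechet_derivative_eq[OF this]
  have "polar_chart D \<psi> x = \<psi> (polar D (fst x, stereo_inv (snd x)))"
    by (simp add: polar_chart_def norm_eq_1_imp_sgn)
  then show ?thesis
    unfolding pullback_def d
    using warped_pullback_eq[OF rs x, of "stereo_inv (snd x)" "stereo_inv_deriv (snd x) (snd u)"
        "stereo_inv_deriv (snd x) (snd v)" "fst u" "fst v"]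
    by (simp add: stereo_inv_deriv_tangent stereo_inv_deriv_inner power_mult_distrib)
qed

text \<open>A nonzero vector in the kernel of the differential would have length zero in the
  pulled-back metric.\<close>

lemma pullback_pos_imp_inj:
  assumes g: "riemannian_metric g" and "\<phi> x \<in> unit_sphere" "\<phi> differentiable (at x)"
    and pos: "\<And>u. u \<noteq> 0 \<Longrightarrow> pullback \<phi> g x u u > 0"
  shows "inj (frechet_derivative \<phi> (at x))"
proof -
  have "linear (frechet_derivative \<phi> (at x))"
    using assms(3) by (rule linear_frechet_derivative)
  moreover have "u = 0" if "frechet_derivative \<phi> (at x) u = 0" for u
    using pos[of u] that riemannian_metric_zero[OF g assms(2)] unfolding pullback_def by auto
  ultimately show ?thesis by (simp add: linear_injective_0)
qed

text \<open>This makes \<open>scal_ge\<close> applicable. Injectivity is inherited from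
  \<open>\<psi>\<close>, from polar coordinates off the ends and from the stereographic projection;
  the differential is injective because the warped metric is positive definite there.\<close>

lemma local_param_polar_chart:
  assumes rs: "rotationally_symmetric_via D f \<psi> g" and g: "riemannian_metric g"
  shows "local_param ({0<..<D} \<times> UNIV) (polar_chart D \<psi>)"
proof -
  let ?U = "{0<..<D} \<times> (UNIV :: 'a set)" and ?\<phi> = "polar_chart D \<psi>"
  have \<psi>: "sphere_diffeo \<psi>" and wf: "warping_function D f"
    using rs unfolding rotationally_symmetric_via_def by auto
  have "0 < D" and fpos: "\<And>s. s \<in> {0<..<D} \<Longrightarrow> f s > 0"
    using wf unfolding warping_function_def by auto
  have U: "open ?U" by (simp add: open_Times)
  have smooth: "smooth_on ?U ?\<phi>" by (rule smooth_polar_chart[OF \<psi> U])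
  have \<phi>: "?\<phi> x = \<psi> (polar D (fst x, stereo_inv (snd x)))"
    "polar D (fst x, stereo_inv (snd x)) \<in> unit_sphere" for x
    by (simp_all add: polar_chart_def norm_eq_1_imp_sgn)
  have im: "?\<phi> x \<in> unit_sphere" for x
    unfolding \<phi>(1) by (rule sphere_diffeo_in_sphere[OF \<psi> \<phi>(2)])
  have "inj_on ?\<phi> ?U"
  proof (rule inj_onI)
    fix x y assume xy: "x \<in> ?U" "y \<in> ?U" "?\<phi> x = ?\<phi> y"
    have "inj_on \<psi> unit_sphere" using \<psi> unfolding sphere_diffeo_def bij_betw_def by blast
    then have "polar D (fst x, stereo_inv (snd x)) = polar D (fst y, stereo_inv (snd y))"
      by (rule inj_onD[OF _ xy(3)[unfolded \<phi>(1)] \<phi>(2) \<phi>(2)])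
    then have "fst x = fst y \<and> stereo_inv (snd x) = stereo_inv (snd y)"
      using xy(1,2) by (intro polar_inj[OF \<open>0 < D\<close>]) auto
    then show "x = y" using inj_stereo_inv by (metis injD prod_eqI)
  qed
  moreover have "inj (frechet_derivative ?\<phi> (at x))" if x: "x \<in> ?U" for x
  proof (rule pullback_pos_imp_inj[OF g])
    show "?\<phi> x \<in> unit_sphere" by (rule im)
    have "Ck_on (Suc 0) ?U ?\<phi>" using smooth unfolding smooth_on_def by blast
    then show "?\<phi> differentiable (at x)" using x unfolding Ck_on.simps by blast
    have x': "fst x \<in> {0<..<D}" using x by auto
    show "pullback ?\<phi> g x u u > 0" if "u \<noteq> 0" for u
    proof -
      have "0 < (f (fst x) * stereo_factor (snd x))\<^sup>2"
        using fpos[OF x'] stereo_factor_pos[of "snd x"] by simp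
      then show ?thesis
        unfolding polar_chart_metric[OF rs x'] using that
        by (cases "snd u = 0") (auto simp: prod_eq_iff zero_less_mult_iff intro!: add_nonneg_pos)
    qed
  qed
  ultimately show ?thesis
    unfolding local_param_def using U smooth im by blast
qed

text \<open>The curvature formula at \<open>(s, 0)\<close>, divided by \<open>DIM('b)\<close> and
  multiplied by \<open>f^2\<close>. With \<open>n = DIM('b) + 1\<close> the lower bound
  \<open>n (n - 1)\<close> contains exactly the factor divided out.\<close>

lemma scal_ge_imp_warping_ineq:
  fixes g :: "(real \<times> (real \<times> 'b::euclidean_space)) bilinear_field"
  assumes rs: "rotationally_symmetric_via D f \<psi> g" and g: "riemannian_metric g"
    and scal: "scal_ge g ((real DIM('b) + 1) * real DIM('b))" and s: "s \<in> {0<..<D}"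
  shows "(real DIM('b) + 1) * (f s)\<^sup>2 \<le> (real DIM('b) - 1) * (1 - (deriv_within {0..D} f s)\<^sup>2)
    - 2 * f s * deriv_within {0..D} (deriv_within {0..D} f) s"
proof -
  let ?U = "{0<..<D} \<times> (UNIV :: 'b set)" and ?f1 = "deriv_within {0..D} f"
    and ?h = "pullback (polar_chart D \<psi>) g"
  let ?f2 = "deriv_within {0..D} ?f1"
  have wf: "warping_function D f" using rs unfolding rotationally_symmetric_via_def by auto
  have at: "at t within {0..D} = at t" if "t \<in> {0<..<D}" for t
    using that by (intro at_within_interior) (simp add: interior_atLeastAtMost_real)
  have fpos: "f t > 0" if "t \<in> {0<..<D}" for t
    using wf that unfolding warping_function_def by auto
  have d: "(f has_real_derivative ?f1 t) (at t)" "(?f1 has_real_derivative ?f2 t) (at t)"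
    if "t \<in> {0<..<D}" for t
    using warping_function_derivatives[OF wf, of t] at[OF that] that by auto
  have "scalar_curvature ?h (s, 0) =
      real DIM('b) * ((real DIM('b) - 1) * (1 - (?f1 s)\<^sup>2) / (f s)\<^sup>2 - 2 * ?f2 s / f s)"
  proof (rule scalar_curvature_warped_sphere)
    show "open ?U" by (simp add: open_Times)
    show "\<forall>x\<in>?U. \<forall>u v. ?h x u v
        = fst u * fst v + (f (fst x) * stereo_factor (snd x))\<^sup>2 * (snd u \<bullet> snd v)"
      using polar_chart_metric[OF rs] by auto
    show "\<forall>x\<in>?U. f (fst x) \<noteq> 0" using fpos by (auto simp: less_le)
  qed (use s d in auto)
  moreover have "scalar_curvature ?h (s, 0) \<ge> (real DIM('b) + 1) * real DIM('b)"
    using scal local_param_polar_chart[OF rs g] s unfolding scal_ge_def by blast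
  ultimately have "real DIM('b) + 1 \<le> (real DIM('b) - 1) * (1 - (?f1 s)\<^sup>2) / (f s)\<^sup>2 - 2 * ?f2 s / f s"
    by (simp add: mult.commute mult_le_cancel_left)
  then have "(real DIM('b) + 1) * (f s)\<^sup>2
      \<le> ((real DIM('b) - 1) * (1 - (?f1 s)\<^sup>2) / (f s)\<^sup>2 - 2 * ?f2 s / f s) * (f s)\<^sup>2"
    by (rule mult_right_mono) simp
  also have "\<dots> = (real DIM('b) - 1) * (1 - (?f1 s)\<^sup>2) - 2 * f s * ?f2 s"
    using fpos[OF s] by (simp add: field_simps power2_eq_square)
  finally show ?thesis .
qed

section \<open>The differential inequality\<close>

text \<open>Here \<open>m\<close> stands for \<open>n - 2\<close>. Only the pole at 0 enters, hence
  the half-open interval; the other pole is reached by reflection.\<close>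

lemma warping_rigid_left:
  fixes f f1 f2 :: "real \<Rightarrow> real" and m :: nat
  assumes f: "\<And>s. 0 < s \<Longrightarrow> s < D \<Longrightarrow> (f has_real_derivative f1 s) (at s)"
    and f1: "\<And>s. 0 < s \<Longrightarrow> s < D \<Longrightarrow> (f1 has_real_derivative f2 s) (at s)"
    and cont: "continuous_on {0..<D} f" "continuous_on {0..<D} f1"
    and pos: "\<And>s. 0 < s \<Longrightarrow> s < D \<Longrightarrow> f s > 0"
    and zero: "f 0 = 0" "f1 0 = 1"
    and "m \<ge> 1"
    and ineq: "\<And>s. 0 < s \<Longrightarrow> s < D \<Longrightarrow>
      real m * (1 - (f1 s)\<^sup>2) - 2 * f s * f2 s \<ge> (real m + 2) * (f s)\<^sup>2"
    and s0: "0 < s0" "s0 < D" "f s0 \<ge> 1" "f1 s0 = 0"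
  shows "s0 = pi / 2" "\<And>s. s \<in> {0..s0} \<Longrightarrow> f s = sin s"
proof -
  define F where "F s = f s ^ m * (1 - (f1 s)\<^sup>2 - (f s)\<^sup>2)" for s
  have dF: "\<exists>d. (F has_real_derivative d) (at s) \<and> 0 \<le> d" if "0 < s" "s < D" "f1 s \<ge> 0" for s
  proof (intro exI conjI)
    let ?d = "f1 s * f s ^ (m - 1) *
      (real m * (1 - (f1 s)\<^sup>2) - 2 * f s * f2 s - (real m + 2) * (f s)\<^sup>2)"
    \<comment> \<open>Splits off one factor \<open>f s\<close>, so that both summands of the
      derivative share \<open>f1 s * f s ^ (m - 1)\<close>; the natural subtraction is genuine since
      \<open>m \<ge> 1\<close>.\<close>
    have m: "f s ^ m = f s * f s ^ (m - 1)"
      using \<open>m \<ge> 1\<close> by (metis Suc_diff_1 Suc_le_lessD One_nat_def power_Suc)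
    have "(F has_real_derivative real m * f s ^ (m - 1) * f1 s * (1 - (f1 s)\<^sup>2 - (f s)\<^sup>2)
        + f s ^ m * (- (2 * f1 s * f2 s) - 2 * f s * f1 s)) (at s)"
      unfolding F_def by (auto intro!: derivative_eq_intros f[OF that(1,2)] f1[OF that(1,2)])
    then show "(F has_real_derivative ?d) (at s)"
      by (rule DERIV_cong) (simp add: m algebra_simps power2_eq_square)
    show "0 \<le> ?d"
      using ineq[OF that(1,2)] pos[OF that(1,2)] that(3) by (intro mult_nonneg_nonneg) auto
  qed
  have contF: "continuous_on {a..b} F" if "0 \<le> a" "b < D" for a b
    unfolding F_def using that
    by (intro continuous_intros continuous_on_subset[OF cont(1)] continuous_on_subset[OF cont(2)]) auto
  have F_mono: "F a \<le> F b" if "0 \<le> a" "a \<le> b" "b < D"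
    and f1_ab: "\<And>s. a < s \<Longrightarrow> s < b \<Longrightarrow> f1 s > 0" for a b
  proof (rule DERIV_nonneg_imp_increasing_open[OF that(2) _ contF[OF that(1,3)]])
    show "\<exists>y. (F has_real_derivative y) (at x) \<and> 0 \<le> y" if x: "a < x" "x < b" for x
      using dF[of x] x \<open>0 \<le> a\<close> \<open>b < D\<close> f1_ab[OF x] by simp
  qed
  have F_s0: "F s0 \<le> 0"
  proof -
    have "(f s0)\<^sup>2 \<ge> 1" using s0 by (simp add: one_le_power)
    then show ?thesis unfolding F_def using s0 by (intro mult_nonneg_nonpos) auto
  qed
  \<comment> \<open>At such a critical point the inequality becomes
    \<open>2 f f'' \<le> m - (m + 2) f^2\<close>, and the right side is at most
    \<open>-2\<close>.\<close>
  have concave: "f2 s < 0" if "0 < s" "s < D" "f1 s = 0" "f s \<ge> 1" for s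
  proof (rule ccontr)
    assume "\<not> f2 s < 0"
    then have "0 \<le> 2 * f s * f2 s" using that by auto
    then have "(real m + 2) * (f s)\<^sup>2 \<le> real m" using ineq[OF that(1,2)] that(3) by simp
    moreover have "(real m + 2) * 1 \<le> (real m + 2) * (f s)\<^sup>2"
      using that(4) by (intro mult_left_mono) (auto simp: one_le_power)
    ultimately have "(real m + 2) * 1 \<le> real m" by (rule order_trans[rotated])
    then show False by simp
  qed
  have f1_pos: "f1 t > 0" if t: "0 \<le> t" "t < s0" for t
  proof (rule ccontr)
    assume "\<not> f1 t > 0"
    obtain e where e: "e > 0" "\<And>h. h > 0 \<Longrightarrow> h < e \<Longrightarrow> f1 (s0 - h) > 0"
      using DERIV_neg_dec_left[OF f1[OF s0(1,2)] concave[OF s0(1,2,4,3)]] s0 by force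
    \<comment> \<open>Since \<open>f1 s0 = 0\<close>, the set of points with
      \<open>f1 \<le> 0\<close> must be cut off before \<open>s0\<close> to have a largest element
      left of \<open>s0\<close>. Nothing is lost, because \<open>f1\<close> is positive on the gap
      by the choice of \<open>e\<close>.\<close>
    define b where "b = s0 - e / 2"
    define A where "A = {s \<in> {0..max t b}. f1 s \<le> 0}"
    have "b < s0" using e unfolding b_def by simp
    have "t \<in> A" using t \<open>\<not> f1 t > 0\<close> unfolding A_def by auto
    then have "A \<noteq> {}" by blast
    have "continuous_on {0..max t b} f1"
      using cont(2) by (rule continuous_on_subset) (use t s0 \<open>b < s0\<close> in auto)
    then have "closed A"
      unfolding A_def by (intro continuous_on_closed_Collect_le continuous_intros) auto
    moreover have "bounded A"
      unfolding A_def by (rule bounded_subset[of "{0..max t b}"]) auto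
    ultimately obtain a where a: "a \<in> A" "\<And>x. x \<in> A \<Longrightarrow> x \<le> a"
      using compact_attains_sup[of A] \<open>A \<noteq> {}\<close> by (auto simp: compact_eq_bounded_closed)
    have a0: "0 \<le> a" "a < s0" "f1 a \<le> 0"
      using a(1) t \<open>b < s0\<close> unfolding A_def by auto
    have gt: "f1 s > 0" if "a < s" "s < s0" for s
    proof (cases "s \<le> max t b")
      case True
      then show ?thesis using a(2)[of s] that a0 unfolding A_def by force
    next
      case False
      then show ?thesis using e(2)[of "s0 - s"] that unfolding b_def by (auto simp: max_def split: if_splits)
    qed
    have "a > 0" using a0 zero by (cases "a = 0") auto
    have da: "(f1 has_real_derivative f2 a) (at a)" using f1 \<open>a > 0\<close> a0 s0 by simp
    \<comment> \<open>A limit from the right of positive values; together with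
      \<open>f1 a \<le> 0\<close> it makes \<open>a\<close> a critical point.\<close>
    have "f1 a \<ge> 0"
    proof (rule tendsto_lowerbound)
      show "(f1 \<longlongrightarrow> f1 a) (at_right a)"
        using DERIV_isCont[OF da] by (simp add: isCont_def filterlim_at_split)
      show "\<forall>\<^sub>F x in at_right a. 0 \<le> f1 x"
        using eventually_at_right_less gt a0 unfolding eventually_at_right_field
        by (meson less_imp_le)
    qed simp
    then have "f1 a = 0" using a0 by simp
    have "F a \<le> F s0" using F_mono[of a s0] a0 s0 gt by auto
    then have "f a ^ m * (1 - (f a)\<^sup>2) \<le> 0"
      using F_s0 \<open>f1 a = 0\<close> unfolding F_def by simp
    then have "1 \<le> (f a)\<^sup>2"
      using zero_less_power[OF pos[of a], of m] \<open>a > 0\<close> a0 s0 by (auto simp: mult_le_0_iff)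
    then have "f a \<ge> 1"
      using pos[of a] \<open>a > 0\<close> a0 s0 by (auto intro: power2_le_imp_le)
    then have "f2 a < 0" using concave \<open>f1 a = 0\<close> \<open>a > 0\<close> a0 s0 by simp
    then obtain d where d: "d > 0" "\<And>h. h > 0 \<Longrightarrow> h < d \<Longrightarrow> f1 (a + h) < f1 a"
      using DERIV_neg_dec_right[OF da] by blast
    \<comment> \<open>A step short enough both for the decrease of \<open>f1\<close> after
      \<open>a\<close> and for staying left of \<open>s0\<close>, where \<open>f1\<close> is
      positive.\<close>
    define h where "h = min (d / 2) ((s0 - a) / 2)"
    have "h > 0" "h < d" "a + h < s0" using d(1) a0 unfolding h_def by (auto simp: min_def field_simps)
    then show False using d(2)[of h] gt[of "a + h"] \<open>f1 a = 0\<close> by simp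
  qed
  have unit: "(f1 s)\<^sup>2 + (f s)\<^sup>2 = 1" if "0 < s" "s \<le> s0" for s
  proof -
    have "F 0 \<le> F s" "F s \<le> F s0" using f1_pos s0 that by (auto intro!: F_mono)
    moreover have "F 0 = 0" using zero \<open>m \<ge> 1\<close> unfolding F_def by simp
    ultimately have "F s = 0" using F_s0 by simp
    then show ?thesis using pos[of s] that s0 unfolding F_def by simp
  qed
  have "\<bar>f s0\<bar> = 1" using unit[of s0] s0 by (simp add: power2_eq_1_iff)
  then have "f s0 = 1" using s0 by simp
  have bnd: "-1 \<le> f s \<and> f s \<le> 1" if "s \<in> {0..s0}" for s
  proof (cases "s = 0")
    case False
    then have "(f s)\<^sup>2 \<le> 1" using unit[of s] that by (smt (verit) atLeastAtMost_iff zero_le_power2)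
    then show ?thesis by (simp add: abs_le_iff abs_square_le_1 minus_le_iff)
  qed (use zero in auto)
  \<comment> \<open>Integrates \<open>f' = sqrt (1 - f^2)\<close>, the sign of the root being fixed
    by \<open>f' > 0\<close>. The derivative is taken on the open interval only, since
    \<open>arcsin\<close> is not differentiable at the value 1 reached at \<open>s0\<close>.\<close>
  have "arcsin (f s) - s = 0" if "s \<in> {0..s0}" for s
  proof -
    have "arcsin (f s) - s = arcsin (f 0) - 0"
    proof (rule DERIV_isconst2[of 0 s0])
      show "continuous_on {0..s0} (\<lambda>s. arcsin (f s) - s)"
        using bnd s0 by (intro continuous_intros continuous_on_subset[OF cont(1)]) auto
      show "((\<lambda>s. arcsin (f s) - s) has_real_derivative 0) (at x)" if x: "0 < x" "x < s0" for x
      proof -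
        have "f1 x > 0" "f x > 0" using f1_pos x pos s0 by auto
        have u: "(f1 x)\<^sup>2 = 1 - (f x)\<^sup>2" using unit[of x] x by simp
        have sq: "sqrt (1 - (f x)\<^sup>2) = f1 x" using \<open>f1 x > 0\<close> unfolding u[symmetric] by simp
        have "0 < (f1 x)\<^sup>2" using \<open>f1 x > 0\<close> by simp
        then have "(f x)\<^sup>2 < 1" using u by simp
        then have "f x < 1" using \<open>f x > 0\<close> by (simp add: abs_square_less_1)
        then show ?thesis
          using \<open>f x > 0\<close> f[of x] x s0 sq \<open>f1 x > 0\<close>
          by (auto intro!: derivative_eq_intros)
      qed
    qed (use s0 that in auto)
    then show ?thesis using zero by simp
  qed
  then have arcsin: "arcsin (f s) = s" if "s \<in> {0..s0}" for s using that by force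
  show "s0 = pi / 2" using arcsin[of s0] \<open>f s0 = 1\<close> s0 by simp
  show "f s = sin s" if "s \<in> {0..s0}" for s
    using arcsin[OF that] bnd[OF that] sin_arcsin[of "f s"] by simp
qed

text \<open>The reflection \<open>s \<mapsto> D - s\<close> exchanges the poles and preserves the
  inequality: \<open>f1\<close> changes sign but enters squared, and \<open>f2\<close> keeps its
  sign. Either side of the maximum thus has length \<open>pi / 2\<close>.\<close>

lemma warping_rigid:
  fixes f f1 f2 :: "real \<Rightarrow> real" and m :: nat
  assumes f: "\<And>s. 0 < s \<Longrightarrow> s < D \<Longrightarrow> (f has_real_derivative f1 s) (at s)"
    and f1: "\<And>s. 0 < s \<Longrightarrow> s < D \<Longrightarrow> (f1 has_real_derivative f2 s) (at s)"
    and cont: "continuous_on {0..D} f" "continuous_on {0..D} f1"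
    and pos: "\<And>s. 0 < s \<Longrightarrow> s < D \<Longrightarrow> f s > 0"
    and ends: "f 0 = 0" "f D = 0" "f1 0 = 1" "f1 D = -1"
    and "m \<ge> 1"
    and ineq: "\<And>s. 0 < s \<Longrightarrow> s < D \<Longrightarrow>
      real m * (1 - (f1 s)\<^sup>2) - 2 * f s * f2 s \<ge> (real m + 2) * (f s)\<^sup>2"
    and large: "s1 \<in> {0..D}" "f s1 \<ge> 1"
  shows "D = pi" "\<And>s. s \<in> {0..D} \<Longrightarrow> f s = sin s"
proof -
  obtain s0 where s0: "s0 \<in> {0..D}" "\<And>s. s \<in> {0..D} \<Longrightarrow> f s \<le> f s0"
    using continuous_attains_sup[of "{0..D}" f] cont(1) large(1) by auto
  have big: "f s0 \<ge> 1" using s0(2)[OF large(1)] large(2) by simp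
  then have s0': "0 < s0" "s0 < D" using s0(1) ends by (auto simp: less_le)
  have "f1 s0 = 0"
  proof (rule DERIV_local_max[OF f[OF s0'], of "min s0 (D - s0)"])
    show "\<forall>y. \<bar>s0 - y\<bar> < min s0 (D - s0) \<longrightarrow> f y \<le> f s0"
      by (intro allI impI s0(2)) (auto simp: abs_if split: if_splits)
  qed (use s0' in auto)
  have cont_left: "continuous_on {0..<D} f" "continuous_on {0..<D} f1"
    by (rule continuous_on_subset[OF cont(1)] continuous_on_subset[OF cont(2)]; auto)+
  have left: "s0 = pi / 2" "\<And>s. s \<in> {0..s0} \<Longrightarrow> f s = sin s"
    using warping_rigid_left[of D f f1 f2 m s0, OF f f1 cont_left pos ends(1,3) \<open>m \<ge> 1\<close> ineq s0' big \<open>f1 s0 = 0\<close>]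
    by blast+
  have refl: "((\<lambda>s. h (D - s)) has_real_derivative - h') (at s)"
    if "(h has_real_derivative h') (at (D - s))" for h h' s
  proof -
    have "((\<lambda>s. D - s) has_real_derivative - 1) (at s)" by (auto intro!: derivative_eq_intros)
    from DERIV_chain2[of h h' "\<lambda>s. D - s", OF that this] show ?thesis by simp
  qed
  have right: "D - s0 = pi / 2" "\<And>s. s \<in> {0..D - s0} \<Longrightarrow> f (D - s) = sin s"
  proof -
    let ?f = "\<lambda>s. f (D - s)" and ?f1 = "\<lambda>s. - f1 (D - s)" and ?f2 = "\<lambda>s. f2 (D - s)"
    have a: "(?f has_real_derivative ?f1 s) (at s)" if "0 < s" "s < D" for s
      using refl[OF f] that by simp
    have b: "(?f1 has_real_derivative ?f2 s) (at s)" if "0 < s" "s < D" for s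
      using DERIV_minus[OF refl[OF f1]] that by simp
    have c: "continuous_on {0..<D} ?f" "continuous_on {0..<D} ?f1"
      by (intro continuous_intros continuous_on_compose2[OF cont(1)] continuous_on_compose2[OF cont(2)]; auto)+
    have d: "real m * (1 - (?f1 s)\<^sup>2) - 2 * ?f s * ?f2 s \<ge> (real m + 2) * (?f s)\<^sup>2"
      if "0 < s" "s < D" for s
      using ineq[of "D - s"] that by simp
    have "?f s > 0" if "0 < s" "s < D" for s
      using pos[of "D - s"] that by simp
    moreover have "?f 0 = 0" "?f1 0 = 1" "0 < D - s0" "D - s0 < D" "?f (D - s0) \<ge> 1" "?f1 (D - s0) = 0"
      using ends s0' big \<open>f1 s0 = 0\<close> by simp_all
    ultimately show "D - s0 = pi / 2" "\<And>s. s \<in> {0..D - s0} \<Longrightarrow> f (D - s) = sin s"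
      using warping_rigid_left[of D ?f ?f1 ?f2 m "D - s0", OF a b c _ _ _ \<open>m \<ge> 1\<close> d] by blast+
  qed
  show D: "D = pi" using left(1) right(1) by simp
  show "f s = sin s" if "s \<in> {0..D}" for s
  proof (cases "s \<le> s0")
    case True
    then show ?thesis using left(2) that by simp
  next
    case False
    then have "f (D - (D - s)) = sin (D - s)" using that by (intro right(2)) auto
    then show ?thesis using D by (simp add: sin_diff)
  qed
qed

section \<open>The isometry with the round sphere\<close>

text \<open>For \<open>D = pi\<close> the map \<open>polar D\<close> is the usual polar
  parametrization of the round sphere, in which the round metric is
  \<open>ds^2 + sin(s)^2 g_rd\<close>, the form assumed for the pullback of \<open>g\<close> under
  \<open>\<psi>\<close>.\<close>

lemma round_off_poles:
  fixes q :: "real \<times> 'a::euclidean_space"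
  assumes rs: "rotationally_symmetric_via D f \<psi> g" and D: "D = pi" and f: "\<And>s. s \<in> {0..D} \<Longrightarrow> f s = sin s"
    and q: "q \<in> unit_sphere" "snd q \<noteq> 0" and uv: "u \<in> tangent_space q" "v \<in> tangent_space q"
  shows "g (\<psi> q) (frechet_derivative (\<lambda>x. \<psi> (sgn x)) (at q) u)
    (frechet_derivative (\<lambda>x. \<psi> (sgn x)) (at q) v) = u \<bullet> v"
proof -
  define s where "s = arccos (fst q)"
  define \<theta> where "\<theta> = sgn (snd q)"
  have nq: "(fst q)\<^sup>2 + (norm (snd q))\<^sup>2 = 1"
    using q(1) by (cases q) (simp add: norm_Pair)
  moreover have "0 < (norm (snd q))\<^sup>2" using q(2) by simp
  ultimately have "(fst q)\<^sup>2 < 1" by linarith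
  then have lt: "-1 < fst q" "fst q < 1" by (auto simp: abs_square_less_1)
  then have s: "s \<in> {0<..<D}" and cos: "cos s = fst q"
    unfolding s_def D using arccos_lt_bounded[of "fst q"] by auto
  have sin: "sin s = norm (snd q)"
    using nq lt by (simp add: s_def sin_arccos) (metis add_diff_cancel_left' norm_ge_zero real_sqrt_unique)
  have sin0: "sin s > 0" using sin q(2) by simp
  have \<theta>: "norm \<theta> = 1" "\<theta> \<bullet> \<theta> = 1" using q(2) by (auto simp: \<theta>_def norm_sgn norm_eq_1[symmetric])
  have "snd q = sin s *\<^sub>R \<theta>" unfolding sin \<theta>_def using q(2) by (simp add: sgn_div_norm)
  then have qs: "q = (cos s, sin s *\<^sub>R \<theta>)" using cos by (simp add: prod_eq_iff)
  then have polar: "polar D (s, \<theta>) = q" by (simp add: polar_def D)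
  \<comment> \<open>\<open>a w\<close> and \<open>t w\<close> are the radial and spherical
    components of \<open>w\<close>, obtained by solving \<open>fst w = - sin s * a\<close> and then
    \<open>snd w = (cos s * a) *\<^sub>R \<theta> + sin s *\<^sub>R t\<close> for \<open>a\<close>
    and \<open>t\<close>.\<close>
  define a where "a w = - fst w / sin s" for w :: "real \<times> 'a"
  define t where "t w = (1 / sin s) *\<^sub>R (snd w - (cos s * a w) *\<^sub>R \<theta>)" for w :: "real \<times> 'a"
  have tan: "t w \<in> tangent_space \<theta>" and w: "frechet_derivative (polar D) (at (s, \<theta>)) (a w, t w) = w"
    if "w \<in> tangent_space q" for w
  proof -
    have "cos s * fst w + sin s * (\<theta> \<bullet> snd w) = 0"
      using that unfolding tangent_space_def qs by (cases w) simp
    then have "\<theta> \<bullet> snd w = cos s * a w"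
      using sin0 by (simp add: a_def field_simps)
    then show "t w \<in> tangent_space \<theta>"
      by (simp add: t_def tangent_space_def inner_diff_right \<theta>)
    show "frechet_derivative (polar D) (at (s, \<theta>)) (a w, t w) = w"
      using frechet_derivative_eq[OF has_derivative_polar[of D s \<theta>], of "(a w, t w)"] sin0
      by (simp add: D a_def t_def prod_eq_iff)
  qed
  have inner: "x \<bullet> y = a x * a y + (sin s)\<^sup>2 * (t x \<bullet> t y)" if "x \<in> tangent_space q" "y \<in> tangent_space q" for x y
  proof -
    have x: "x = (- (sin s * a x), (cos s * a x) *\<^sub>R \<theta> + sin s *\<^sub>R t x)"
      and y: "y = (- (sin s * a y), (cos s * a y) *\<^sub>R \<theta> + sin s *\<^sub>R t y)"
      using sin0 by (simp_all add: a_def t_def prod_eq_iff)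
    have tt: "\<theta> \<bullet> t x = 0" "\<theta> \<bullet> t y = 0" using tan that unfolding tangent_space_def by auto
    have "x \<bullet> y = ((sin s)\<^sup>2 + (cos s)\<^sup>2) * (a x * a y) + (sin s)\<^sup>2 * (t x \<bullet> t y)"
      by (subst x, subst y)
        (simp add: inner_add_left inner_add_right tt \<theta> inner_commute[of "t x" \<theta>] power2_eq_square algebra_simps
          del: sin_cos_squared_add sin_cos_squared_add2 sin_cos_squared_add3)
    then show ?thesis by simp
  qed
  have "f s = sin s" using f s by simp
  then show ?thesis
    using warped_pullback_eq[OF rs s _ tan[OF uv(1)] tan[OF uv(2)], of "a u" "a v"] \<theta>(1)
    unfolding polar w[OF uv(1)] w[OF uv(2)] inner[OF uv] by simp
qed

section \<open>Charts at the poles and the extension across them\<close>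

lemma sgn_deriv_tangent: "x \<noteq> 0 \<Longrightarrow> sgn_deriv x v \<in> tangent_space (sgn x)"
  using norm_sgn[of x] by (simp add: sgn_deriv_def tangent_space_def inner_diff_right norm_eq_1)

text \<open>The double inverse agrees with \<open>\<psi>\<close> on the sphere, which suffices for
  smoothness because the extension evaluates it only at points \<open>sgn x\<close>.\<close>

lemma sphere_diffeo_inverse:
  assumes "sphere_diffeo \<psi>"
  shows "p \<in> unit_sphere \<Longrightarrow> inv_into unit_sphere \<psi> (\<psi> p) = p"
    and "p \<in> unit_sphere \<Longrightarrow> \<psi> (inv_into unit_sphere \<psi> p) = p"
    and "sphere_diffeo (inv_into unit_sphere \<psi>)"
proof -
  have bij: "bij_betw \<psi> unit_sphere unit_sphere" and \<psi>: "smooth_on_sphere \<psi>"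
    and inv: "smooth_on_sphere (inv_into unit_sphere \<psi>)"
    using assms unfolding sphere_diffeo_def by auto
  show "inv_into unit_sphere \<psi> (\<psi> p) = p" if "p \<in> unit_sphere"
    using bij_betw_inv_into_left[OF bij that] .
  show "\<psi> (inv_into unit_sphere \<psi> p) = p" if "p \<in> unit_sphere"
    using bij_betw_inv_into_right[OF bij that] .
  have "Ck_on k (- {0}) (\<lambda>x. inv_into unit_sphere (inv_into unit_sphere \<psi>) (sgn x))" for k
  proof (subst Ck_on_cong)
    show "Ck_on k (- {0}) (\<lambda>x. \<psi> (sgn x))"
      using \<psi> unfolding smooth_on_sphere_def smooth_on_def by blast
    show "inv_into unit_sphere (inv_into unit_sphere \<psi>) (sgn x) = \<psi> (sgn x)" if "x \<in> - {0}" for x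
      using inv_into_inv_into_eq[OF bij sgn_in_unit_sphere] that by simp
  qed auto
  then show "sphere_diffeo (inv_into unit_sphere \<psi>)"
    using bij_betw_inv_into[OF bij] inv unfolding sphere_diffeo_def smooth_on_sphere_def smooth_on_def by blast
qed

text \<open>The map \<open>y \<mapsto> sgn (e, y)\<close> projects the hyperplane at height
  \<open>e\<close> centrally onto an open hemisphere. It covers a pole, which polar coordinates
  miss.\<close>

lemma has_derivative_pole_chart:
  assumes "sphere_diffeo \<psi>" "e \<noteq> 0"
  shows "((\<lambda>y. \<psi> (sgn (e, y))) has_derivative (\<lambda>v. frechet_derivative (\<lambda>x. \<psi> (sgn x)) (at (sgn (e, y)))
    (sgn_deriv (e, y) (0, v)))) (at y)"
proof -
  have z: "(e, y) \<noteq> 0" using assms(2) by (simp add: zero_prod_def)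
  have \<psi>: "smooth_on_sphere \<psi>" using assms(1) unfolding sphere_diffeo_def by blast
  have "((\<lambda>y. (e, y)) has_derivative (\<lambda>v. (0, v))) (at y)"
    by (auto intro!: derivative_eq_intros)
  from has_derivative_compose[OF this smooth_on_sphere_has_derivative[OF \<psi> z]]
  show ?thesis unfolding sgn_deriv_chain[OF \<psi> z] .
qed

lemma local_param_pole_chart:
  fixes \<psi> :: "real \<times> 'a::euclidean_space \<Rightarrow> real \<times> 'a"
  assumes \<psi>: "sphere_diffeo \<psi>" and e: "e \<noteq> 0"
  shows "local_param UNIV (\<lambda>y. \<psi> (sgn (e, y)))"
proof -
  have sm: "smooth_on_sphere \<psi>" "smooth_on_sphere (inv_into unit_sphere \<psi>)"
    using \<psi> unfolding sphere_diffeo_def by auto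
  have z: "(e, y) \<noteq> 0" for y :: 'a using e by (simp add: zero_prod_def)
  note in_sphere = sgn_in_unit_sphere[OF z]
  have "smooth_on UNIV (\<lambda>y. \<psi> (sgn (e, y)))"
    unfolding smooth_on_def
  proof
    fix k
    have "Ck_on k (- {0}) (\<lambda>z. \<psi> (sgn z))"
      using sm(1) unfolding smooth_on_sphere_def smooth_on_def by blast
    moreover have "Ck_on k UNIV (\<lambda>y::'a. (e, y))"
      by (intro Ck_on_Pair Ck_on_const Ck_on_ident open_UNIV)
    moreover have "range (\<lambda>y. (e, y)) \<subseteq> - {0}"
      using e by (auto simp: zero_prod_def)
    ultimately show "Ck_on k UNIV (\<lambda>y. \<psi> (sgn (e, y)))"
      by (rule Ck_on_compose[OF open_UNIV, rotated])
  qed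
  moreover have "inj (\<lambda>y. \<psi> (sgn (e, y)))"
  proof (rule injI)
    fix x y assume "\<psi> (sgn (e, x)) = \<psi> (sgn (e, y))"
    then have "sgn (e, x) = sgn (e, y)"
      using sphere_diffeo_inverse(1)[OF \<psi> in_sphere] by metis
    then have "e / norm (e, x) = e / norm (e, y)" "x /\<^sub>R norm (e, x) = y /\<^sub>R norm (e, y)"
      by (simp_all add: sgn_div_norm divide_inverse mult.commute)
    then show "x = y" using e z by auto
  qed
  moreover have "inj (frechet_derivative (\<lambda>y. \<psi> (sgn (e, y))) (at y))" for y
  proof -
    let ?d = "frechet_derivative (\<lambda>y. \<psi> (sgn (e, y))) (at y)"
    note D = has_derivative_pole_chart[OF \<psi> e, of y]
    have "linear ?d"
      using D by (intro linear_frechet_derivative) (auto simp: differentiable_def)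
    moreover have "v = 0" if "?d v = 0" for v
    proof -
      let ?w = "sgn_deriv (e, y) (0, v)"
      have "frechet_derivative (\<lambda>x. \<psi> (sgn x)) (at (sgn (e, y))) ?w = 0"
        using that frechet_derivative_eq[OF D] by simp
      moreover have "\<psi> (sgn (e, y)) \<noteq> 0"
        using sphere_diffeo_in_sphere[OF \<psi> in_sphere[of y]] by auto
      ultimately have "?w = 0"
        using sphere_diffeo_deriv_inverse[OF sm sphere_diffeo_in_sphere[OF \<psi>] sphere_diffeo_inverse(1)[OF \<psi>]
            in_sphere sgn_deriv_tangent[OF z], of y "(0, v)"]
          has_derivative_linear[OF smooth_on_sphere_has_derivative[OF sm(2)], THEN linear_0] by metis
      \<comment> \<open>The kernel of \<open>sgn_deriv\<close> is radial, so \<open>(0, v)\<close>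
        is a multiple of \<open>(e, y)\<close>; since \<open>e \<noteq> 0\<close>, comparing first
        components makes the multiple zero.\<close>
      then have w: "(0, v) = (sgn (e, y) \<bullet> (0, v)) *\<^sub>R sgn (e, y)"
        using z[of y] by (simp add: sgn_deriv_def)
      then have "0 = (sgn (e, y) \<bullet> (0, v)) * (e / norm (e, y))"
        by (metis fst_conv fst_scaleR real_scaleR_def sgn_div_norm divide_inverse mult.commute)
      then have "sgn (e, y) \<bullet> (0, v) = 0" using e z[of y] by simp
      then show "v = 0" using w by (simp add: zero_prod_def)
    qed
    ultimately show ?thesis by (simp add: linear_injective_0)
  qed
  ultimately show ?thesis
    unfolding local_param_def using sphere_diffeo_in_sphere[OF \<psi> in_sphere] by auto
qed

text \<open>The components of the metric in the chart are continuous and known away from the pole.\<close>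

lemma round_at_pole_Basis:
  fixes g :: "(real \<times> 'a::euclidean_space) bilinear_field"
  assumes rs: "rotationally_symmetric_via D f \<psi> g" and g: "riemannian_metric g"
    and D: "D = pi" and f: "\<And>s. s \<in> {0..D} \<Longrightarrow> f s = sin s"
    and e: "\<bar>e\<bar> = 1" and ij: "i \<in> Basis" "j \<in> Basis"
  shows "g (\<psi> (e, 0)) (frechet_derivative (\<lambda>x. \<psi> (sgn x)) (at (e, 0)) (0, i))
    (frechet_derivative (\<lambda>x. \<psi> (sgn x)) (at (e, 0)) (0, j)) = i \<bullet> j"
proof -
  have \<psi>: "sphere_diffeo \<psi>" using rs unfolding rotationally_symmetric_via_def by blast
  have e0: "e \<noteq> 0" using e by auto
  have z: "(e, y) \<noteq> 0" for y :: 'a using e0 by (simp add: zero_prod_def)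
  let ?p = "\<lambda>y. pullback (\<lambda>y. \<psi> (sgn (e, y))) g y i j"
  let ?r = "\<lambda>y :: 'a. sgn_deriv (e, y) (0, i) \<bullet> sgn_deriv (e, y) (0, j)"
  have "smooth_on UNIV ?p"
    using g local_param_pole_chart[OF \<psi> e0] ij unfolding riemannian_metric_def by blast
  then have "Ck_on 0 UNIV ?p" unfolding smooth_on_def by blast
  then have p: "(?p \<longlongrightarrow> ?p 0) (at 0)"
    by (simp add: continuous_on_eq_continuous_at isCont_def)
  have "isCont ?r 0"
  proof -
    have 1: "isCont (\<lambda>y::'a. (e, y)) 0" by (intro continuous_intros)
    have 2: "isCont (\<lambda>y::'a. sgn (e, y)) 0" by (rule isCont_sgn[OF 1 z])
    have "norm (e, 0::'a) \<noteq> 0" using e by (simp add: norm_Pair)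
    then have 3: "isCont (\<lambda>y::'a. 1 / norm (e, y)) 0"
      by (intro continuous_divide continuous_const continuous_norm 1) (simp add: Lim_ident_at)
    show ?thesis
      unfolding sgn_deriv_def
      by (intro continuous_inner continuous_scaleR continuous_diff continuous_const 2 3)
  qed
  then have r: "(?r \<longlongrightarrow> ?r 0) (at 0)" by (simp add: isCont_def)
  have eq: "?p y = g (\<psi> (sgn (e, y)))
      (frechet_derivative (\<lambda>x. \<psi> (sgn x)) (at (sgn (e, y))) (sgn_deriv (e, y) (0, i)))
      (frechet_derivative (\<lambda>x. \<psi> (sgn x)) (at (sgn (e, y))) (sgn_deriv (e, y) (0, j)))" for y
    unfolding pullback_def frechet_derivative_eq[OF has_derivative_pole_chart[OF \<psi> e0]] ..
  have "?p y = ?r y" if "y \<noteq> 0" for y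
  proof -
    have "snd (sgn (e, y)) \<noteq> 0" using that z[of y] by (simp add: sgn_div_norm)
    then show ?thesis
      unfolding eq using round_off_poles[OF rs D f sgn_in_unit_sphere[OF z[of y]]] sgn_deriv_tangent[OF z] by blast
  qed
  then have "\<forall>\<^sub>F y in at 0. ?p y = ?r y" by (simp add: eventually_at_filter)
  then have "(?r \<longlongrightarrow> ?p 0) (at 0)" using p by (simp add: tendsto_cong)
  then have "?p 0 = ?r 0" using r by (intro tendsto_unique[of "at (0::'a)"]) auto
  moreover have n: "norm (e, 0::'a) = 1" using e by (simp add: norm_Pair)
  moreover have "sgn_deriv (e, 0) (0, v) = (0, v)" for v :: 'a
    by (rule sgn_deriv_unit[OF n]) (simp add: tangent_space_def)
  ultimately show ?thesis unfolding eq by (simp add: norm_eq_1_imp_sgn)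
qed

text \<open>Smoothness of a metric is formulated for components at basis vectors, so the limit
  argument yields only those. Bilinearity extends the result, with linearity in the second argument
  supplied by symmetry.\<close>

lemma round_at_pole:
  fixes g :: "(real \<times> 'a::euclidean_space) bilinear_field"
  assumes rs: "rotationally_symmetric_via D f \<psi> g" and g: "riemannian_metric g"
    and D: "D = pi" and f: "\<And>s. s \<in> {0..D} \<Longrightarrow> f s = sin s"
    and e: "\<bar>e\<bar> = 1"
  shows "g (\<psi> (e, 0)) (frechet_derivative (\<lambda>x. \<psi> (sgn x)) (at (e, 0)) (0, u))
    (frechet_derivative (\<lambda>x. \<psi> (sgn x)) (at (e, 0)) (0, w)) = u \<bullet> w"
proof -
  have \<psi>: "sphere_diffeo \<psi>" using rs unfolding rotationally_symmetric_via_def by blast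
  have e1: "(e, 0::'a) \<in> unit_sphere" using e by (simp add: norm_Pair)
  define L where "L v = frechet_derivative (\<lambda>x. \<psi> (sgn x)) (at (e, 0)) (0, v)" for v :: 'a
  let ?p = "\<psi> (e, 0)"
  have p: "?p \<in> unit_sphere" by (rule sphere_diffeo_in_sphere[OF \<psi> e1])
  have L: "L v \<in> tangent_space ?p" for v
    unfolding L_def by (rule sphere_diffeo_deriv_tangent[OF \<psi> e1])
  have "smooth_on_sphere \<psi>" using \<psi> unfolding sphere_diffeo_def by blast
  then have "linear (frechet_derivative (\<lambda>x. \<psi> (sgn x)) (at (e, 0)))"
    using smooth_on_sphere_has_derivative has_derivative_linear e1 by (metis norm_zero mem_sphere_0 zero_neq_one)
  moreover have "linear (\<lambda>v. (0::real, v::'a))" by (auto intro: linearI)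
  ultimately have lin: "linear L"
    using linear_compose[of "\<lambda>v. (0, v)"] unfolding L_def[abs_def] o_def by blast
  have sym: "g ?p (L v) (L w) = g ?p (L w) (L v)" for v w
    using g p L unfolding riemannian_metric_def by blast
  have g_lin: "linear (\<lambda>v. g ?p (L v) (L w))" for w
  proof (rule linearI)
    show "g ?p (L (x + y)) (L w) = g ?p (L x) (L w) + g ?p (L y) (L w)" for x y
      using g p L unfolding riemannian_metric_def linear_add[OF lin] by blast
    show "g ?p (L (c *\<^sub>R x)) (L w) = c *\<^sub>R g ?p (L x) (L w)" for c x
      using g p L unfolding riemannian_metric_def linear_scale[OF lin] real_scaleR_def by blast
  qed
  have "g ?p (L b) (L w) = w \<bullet> b" if b: "b \<in> Basis" for b
  proof -
    have "g ?p (L b) (L w) = (\<Sum>c\<in>Basis. (w \<bullet> c) *\<^sub>R g ?p (L c) (L b))"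
      unfolding sym[of b w] by (rule linear_expand_Basis[OF g_lin])
    also have "\<dots> = (\<Sum>c\<in>Basis. (w \<bullet> c) * (b \<bullet> c))"
      using round_at_pole_Basis[OF rs g D f e _ b]
      by (intro sum.cong[OF refl]) (simp add: L_def inner_commute)
    finally show ?thesis by (simp add: euclidean_inner[of w b])
  qed
  then have "g ?p (L u) (L w) = (\<Sum>b\<in>Basis. (u \<bullet> b) * (w \<bullet> b))"
    by (subst linear_expand_Basis[OF g_lin]) simp
  then show ?thesis by (simp add: L_def euclidean_inner[of u w])
qed

lemma round_imp_isometric:
  fixes g :: "(real \<times> 'a::euclidean_space) bilinear_field"
  assumes rs: "rotationally_symmetric_via D f \<psi> g" and g: "riemannian_metric g"
    and D: "D = pi" and f: "\<And>s. s \<in> {0..D} \<Longrightarrow> f s = sin s"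
  shows "isometric g round_metric"
proof -
  let ?F = "inv_into unit_sphere \<psi>"
  have \<psi>: "sphere_diffeo \<psi>" using rs unfolding rotationally_symmetric_via_def by blast
  have sm: "smooth_on_sphere ?F" "smooth_on_sphere \<psi>" using \<psi> unfolding sphere_diffeo_def by auto
  note inv = sphere_diffeo_inverse[OF \<psi>]
  have round: "g (\<psi> q) (frechet_derivative (\<lambda>x. \<psi> (sgn x)) (at q) u)
      (frechet_derivative (\<lambda>x. \<psi> (sgn x)) (at q) v) = u \<bullet> v"
    if "q \<in> unit_sphere" "u \<in> tangent_space q" "v \<in> tangent_space q" for q u v
  proof (cases "snd q = 0")
    case True
    define e where "e = fst q"
    have q: "q = (e, 0)" using True by (simp add: e_def prod_eq_iff)
    have e: "\<bar>e\<bar> = 1" using that(1) unfolding q by (simp add: norm_Pair)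
    \<comment> \<open>Tangent vectors at a pole are orthogonal to the axis, so their first component
      vanishes.\<close>
    then have "u = (0, snd u)" "v = (0, snd v)"
      using that(2,3) unfolding q tangent_space_def by (auto simp: prod_eq_iff inner_prod_def)
    then show ?thesis
      using round_at_pole[OF rs g D f e, of "snd u" "snd v"] unfolding q by (metis inner_Pair_0(1) snd_conv)
  next
    case False
    then show ?thesis using round_off_poles[OF rs D f that(1) _ that(2,3)] by blast
  qed
  \<comment> \<open>By \<open>round\<close>, \<open>\<psi>\<close> pulls \<open>g\<close> back to
    the round metric, so the inverse of \<open>\<psi>\<close> is the required isometry.\<close>
  have "sphere_pullback ?F round_metric p u v = g p u v"
    if "p \<in> unit_sphere" "u \<in> tangent_space p" "v \<in> tangent_space p" for p u v
  proof -
    let ?d = "frechet_derivative (\<lambda>x. ?F (sgn x)) (at p)"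
    have Fp: "?F p \<in> unit_sphere" by (rule sphere_diffeo_in_sphere[OF inv(3) that(1)])
    have "frechet_derivative (\<lambda>x. \<psi> (sgn x)) (at (?F p)) (?d w) = w" if "w \<in> tangent_space p" for w
      by (rule sphere_diffeo_deriv_inverse[OF sm sphere_diffeo_in_sphere[OF inv(3)] inv(2) \<open>p \<in> unit_sphere\<close> that])
    then have "?d u \<bullet> ?d v = g p u v"
      using round[OF Fp sphere_diffeo_deriv_tangent[OF inv(3) that(1)] sphere_diffeo_deriv_tangent[OF inv(3) that(1)], of u v]
        that inv(2)[OF that(1)] by simp
    then show ?thesis unfolding sphere_pullback_def pullback_def round_metric_def .
  qed
  then show ?thesis unfolding isometric_def using inv(3) by blast
qed

theorem theorem2:
  fixes g :: "(real \<times> (real \<times> (real^'k))) bilinear_field"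
    and \<psi> :: "real \<times> (real \<times> (real^'k)) \<Rightarrow> real \<times> (real \<times> (real^'k))"
    and f :: "real \<Rightarrow> real" and D :: real and n :: nat
  assumes "n = CARD('k) + 1" and "n \<ge> 3"
    and "riemannian_metric g"
    and "rotationally_symmetric_via D f \<psi> g"
    and "scal_ge g (real n * (real n - 1))"
    and "width D \<psi> g \<ge> sphere_volume (round_metric :: (real \<times> (real^'k)) bilinear_field)"
  shows "isometric g round_metric"
proof -
  note g = assms(3) and rs = assms(4)
  let ?f1 = "deriv_within {0..D} f"
  let ?f2 = "deriv_within {0..D} ?f1"
  have wf: "warping_function D f" using rs unfolding rotationally_symmetric_via_def by blast
  have at: "at s within {0..D} = at s" if "0 < s" "s < D" for s
    using that by (intro at_within_interior) (simp add: interior_atLeastAtMost_real)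
  have d: "(f has_real_derivative ?f1 s) (at s)" "(?f1 has_real_derivative ?f2 s) (at s)"
    if "0 < s" "s < D" for s
    using warping_function_derivatives[OF wf, of s] at[OF that] that by auto
  have cont: "continuous_on {0..D} f" "continuous_on {0..D} ?f1"
    using warping_function_derivatives[OF wf] by (blast intro: DERIV_continuous_on)+
  have ends: "f 0 = 0" "f D = 0" "?f1 0 = 1" "?f1 D = -1" and pos: "\<And>s. 0 < s \<Longrightarrow> s < D \<Longrightarrow> f s > 0"
    using wf unfolding warping_function_def by auto
  have scal: "scal_ge g ((real DIM(real^'k) + 1) * real DIM(real^'k))"
    using assms(1,5) by (simp add: add.commute)
  \<comment> \<open>The exponent \<open>m\<close> is \<open>CARD('k) - 1 = n - 2\<close>.\<close>
  have "real (CARD('k) - 1) * (1 - (?f1 s)\<^sup>2) - 2 * f s * ?f2 s \<ge> (real (CARD('k) - 1) + 2) * (f s)\<^sup>2"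
    if "0 < s" "s < D" for s
    using scal_ge_imp_warping_ineq[OF rs g scal, of s] that assms(1,2) by (simp add: of_nat_diff add.commute)
  moreover obtain s1 where "s1 \<in> {0..D}" "f s1 \<ge> 1"
    using width_ge_imp_large[OF rs g assms(6)] by blast
  moreover have "CARD('k) - 1 \<ge> 1" using assms(1,2) by simp
  ultimately have "D = pi" "\<And>s. s \<in> {0..D} \<Longrightarrow> f s = sin s"
    using warping_rigid[of D f ?f1 ?f2 "CARD('k) - 1" s1] d cont pos ends by blast+
  then show ?thesis by (rule round_imp_isometric[OF rs g])
qed

end
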